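(* Consider a geometric evolution law $$X_t = h_1\mathbf{T}+h_2\mathbf{N}+h_3\mathbf{B}$$ for smooth curves immersed in $\mathbb{R}^3$ with strictly positive torsion, where $h_1,h_2,h_3$ are smooth functions of the curvature $\kappa$ and the torsion $\tau$. Up to a rescaling, this evolution is both curvature preserving and arc-length preserving if and only if it is equivalent to $$X_t=\frac{1}{\sqrt{\tau}}\,\mathbf{B}.$$
   Context: $X(s,t)$ is a parametrization by arc-length $s$ of a family $\gamma(t)$ of smooth immersed curves in $\mathbb{R}^3$; $\{\mathbf{T},\mathbf{N},\mathbf{B}\}$ is the Frenet–Serret frame, and $\kappa,\tau$ are the curvature and torsion. The flow is arc-length preserving if $s$ remains an arc-length parameter for all $t$, and curvature preserving if $\kappa_t=0$ at each parameter value $s$. These properties are required of the evolution law for all such curves. "Up to a rescaling" means up to a constant factor: $X_t=\frac{c}{\sqrt\tau}\mathbf{B}$ with $c$ constant. Evolutions differing by a tangential component (a re-parametrization of the curve) are regarded as equivalent. *)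

theory Defs
  imports "HOL-Analysis.Analysis"
begin

section \<open>Smooth functions on open sets\<close>

text \<open>Class C^k through directional derivatives; on an open subset of a finite-dimensional space
  this is the usual notion.\<close>

primrec C_k_on :: "nat \<Rightarrow> 'a::real_normed_vector set \<Rightarrow> ('a \<Rightarrow> 'b::real_normed_vector) \<Rightarrow> bool" where
  "C_k_on 0 S f \<longleftrightarrow> continuous_on S f"
| "C_k_on (Suc k) S f \<longleftrightarrow>
     (\<exists>D. (\<forall>x\<in>S. (f has_derivative D x) (at x)) \<and> (\<forall>v. C_k_on k S (\<lambda>x. D x v)))"

definition smooth_on :: "'a::real_normed_vector set \<Rightarrow> ('a \<Rightarrow> 'b::real_normed_vector) \<Rightarrow> bool" where
  "smooth_on S f \<longleftrightarrow> (\<forall>k. C_k_on k S f)"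


section \<open>The Frenet--Serret apparatus\<close>

text \<open>Curves are regular but not necessarily parametrized by arc length: along a family of curves
  it is part of the claim that the parameter stays an arc-length parameter. Differentiation with
  respect to arc length is therefore differentiation in the parameter divided by the speed.\<close>

definition speed :: "(real \<Rightarrow> real^3) \<Rightarrow> real \<Rightarrow> real" where
  "speed \<gamma> s = norm (vector_derivative \<gamma> (at s))"

definition arc_deriv :: "(real \<Rightarrow> real^3) \<Rightarrow> (real \<Rightarrow> real^3) \<Rightarrow> real \<Rightarrow> real^3" where
  "arc_deriv \<gamma> F s = vector_derivative F (at s) /\<^sub>R speed \<gamma> s"

definition unit_tangent :: "(real \<Rightarrow> real^3) \<Rightarrow> real \<Rightarrow> real^3" where
  "unit_tangent \<gamma> = arc_deriv \<gamma> \<gamma>"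

definition curvature :: "(real \<Rightarrow> real^3) \<Rightarrow> real \<Rightarrow> real" where
  "curvature \<gamma> s = norm (arc_deriv \<gamma> (unit_tangent \<gamma>) s)"

definition unit_normal :: "(real \<Rightarrow> real^3) \<Rightarrow> real \<Rightarrow> real^3" where
  "unit_normal \<gamma> s = arc_deriv \<gamma> (unit_tangent \<gamma>) s /\<^sub>R curvature \<gamma> s"

definition unit_binormal :: "(real \<Rightarrow> real^3) \<Rightarrow> real \<Rightarrow> real^3" where
  "unit_binormal \<gamma> s = cross3 (unit_tangent \<gamma> s) (unit_normal \<gamma> s)"

text \<open>Sign convention: the arc-length derivative of B is -\<tau>N.\<close>

definition torsion :: "(real \<Rightarrow> real^3) \<Rightarrow> real \<Rightarrow> real" where
  "torsion \<gamma> s = - (arc_deriv \<gamma> (unit_binormal \<gamma>) s \<bullet> unit_normal \<gamma> s)"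


section \<open>Geometric evolution laws\<close>

text \<open>A law is the triple of coefficients \<open>(h\<^sub>1, h\<^sub>2, h\<^sub>3)\<close>, each a function of \<kappa> and \<tau>. The frame and the
  torsion require \<open>\<kappa> > 0\<close>, so only the values at \<open>\<kappa> > 0\<close>, \<open>\<tau> > 0\<close> matter.\<close>

type_synonym law =
  "(real \<Rightarrow> real \<Rightarrow> real) \<times> (real \<Rightarrow> real \<Rightarrow> real) \<times> (real \<Rightarrow> real \<Rightarrow> real)"

fun smooth_law :: "law \<Rightarrow> bool" where
  "smooth_law (h1, h2, h3) \<longleftrightarrow>
     (\<forall>h\<in>{h1, h2, h3}. smooth_on ({0<..} \<times> {0<..}) (\<lambda>(\<kappa>, \<tau>). h \<kappa> \<tau>))"

fun velocity :: "law \<Rightarrow> (real \<Rightarrow> real^3) \<Rightarrow> real \<Rightarrow> real^3" where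
  "velocity (h1, h2, h3) \<gamma> s =
     h1 (curvature \<gamma> s) (torsion \<gamma> s) *\<^sub>R unit_tangent \<gamma> s
   + h2 (curvature \<gamma> s) (torsion \<gamma> s) *\<^sub>R unit_normal \<gamma> s
   + h3 (curvature \<gamma> s) (torsion \<gamma> s) *\<^sub>R unit_binormal \<gamma> s"

text \<open>Laws that differ by a tangential component only.\<close>

fun law_equiv :: "law \<Rightarrow> law \<Rightarrow> bool" where
  "law_equiv (h1, h2, h3) (g1, g2, g3) \<longleftrightarrow>
     (\<forall>\<kappa>>0. \<forall>\<tau>>0. h2 \<kappa> \<tau> = g2 \<kappa> \<tau> \<and> h3 \<kappa> \<tau> = g3 \<kappa> \<tau>)"

definition inv_sqrt_torsion_law :: "real \<Rightarrow> law" where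
  "inv_sqrt_torsion_law c = ((\<lambda>\<kappa> \<tau>. 0), (\<lambda>\<kappa> \<tau>. 0), (\<lambda>\<kappa> \<tau>. c / sqrt \<tau>))"

definition arclength_param_on :: "real set \<Rightarrow> (real \<Rightarrow> real^3) \<Rightarrow> bool" where
  "arclength_param_on I \<gamma> \<longleftrightarrow> (\<forall>s\<in>I. speed \<gamma> s = 1)"

text \<open>\<open>X s t\<close> is a smooth family of curves over the open interval \<open>I\<close> which at every time of the
  interval \<open>J\<close> is immersed, has positive curvature and torsion, and moves with the velocity
  prescribed by the law; at some time of \<open>J\<close> the parameter is arc length.

  The interval \<open>J\<close> may be a single instant. A general smooth law is not known to admit solutions, so
  a condition on solutions over nondegenerate intervals only could hold vacuously. With \<open>J = {t}\<close>
  the conditions below are imposed on the first variation of every curve in the direction given by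
  the law; with nondegenerate \<open>J\<close> they are imposed on the solutions.\<close>

definition evolves_by :: "law \<Rightarrow> real set \<Rightarrow> real set \<Rightarrow> (real \<Rightarrow> real \<Rightarrow> real^3) \<Rightarrow> bool" where
  "evolves_by h I J X \<longleftrightarrow>
     open I \<and> is_interval I \<and> is_interval J \<and>
     (\<exists>U. open U \<and> I \<times> J \<subseteq> U \<and> smooth_on U (\<lambda>(s, t). X s t)) \<and>
     (\<forall>t\<in>J. \<forall>s\<in>I.
        speed (\<lambda>s. X s t) s > 0 \<and> curvature (\<lambda>s. X s t) s > 0 \<and> torsion (\<lambda>s. X s t) s > 0 \<and>
        ((\<lambda>t. X s t) has_vector_derivative velocity h (\<lambda>s. X s t) s) (at t)) \<and>
     (\<exists>t\<in>J. arclength_param_on I (\<lambda>s. X s t))"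

text \<open>The derivative condition is implied by the first conjunct unless \<open>J\<close> is a single instant.\<close>

definition arclength_preserving :: "law \<Rightarrow> bool" where
  "arclength_preserving h \<longleftrightarrow>
     (\<forall>I J X. evolves_by h I J X \<longrightarrow>
        (\<forall>t\<in>J. arclength_param_on I (\<lambda>s. X s t) \<and>
           (\<forall>s\<in>I. ((\<lambda>t. speed (\<lambda>s. X s t) s) has_real_derivative 0) (at t))))"

definition curvature_preserving :: "law \<Rightarrow> bool" where
  "curvature_preserving h \<longleftrightarrow>
     (\<forall>I J X. evolves_by h I J X \<longrightarrow>
        (\<forall>t\<in>J. \<forall>s\<in>I. ((\<lambda>t. curvature (\<lambda>s. X s t) s) has_real_derivative 0) (at t)))"

end

theory Submission
  imports Defs
begin


text \<open>Along a curve parametrized by arc length, the velocity \<open>V = h\<^sub>1 T + h\<^sub>2 N + h\<^sub>3 B\<close> changes the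
  speed at the rate \<open>T \<bullet> V' = h\<^sub>1' - \<kappa> h\<^sub>2\<close> and, if that vanishes, the curvature at the rate \<open>N \<bullet> V''\<close>.
  For \<open>V = c\<^sub>1 T + h\<^sub>3 B\<close> the latter is \<open>c\<^sub>1 \<kappa>' - 2 h\<^sub>3' \<tau> - h\<^sub>3 \<tau>'\<close>, which vanishes for \<open>h\<^sub>3 = c / sqrt \<tau>\<close>
  and \<open>c\<^sub>1 = 0\<close>. Conversely there are curves for which \<open>\<kappa>\<close>, \<open>\<tau>\<close>, \<open>\<kappa>'\<close>, \<open>\<tau>'\<close> take arbitrary values at a
  point (with \<open>\<kappa>, \<tau> > 0\<close>). Hence \<open>T \<bullet> V' = 0\<close> forces \<open>h\<^sub>2 = 0\<close> and \<open>h\<^sub>1\<close> constant, and then \<open>N \<bullet> V'' = 0\<close>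
  is a pair of partial differential equations for \<open>h\<^sub>3\<close> with the solutions \<open>c / sqrt \<tau>\<close>.\<close>


section \<open>Calculus of smooth functions\<close>

text \<open>The curvature is not differentiated in time through the frame. In any regular
  parametrization it is an algebraic function of the first two \<open>s\<close>-derivatives of
  \<open>X\<close> (\<open>curvature_eq\<close>), and the time derivatives of these are
  \<open>W'\<close> and \<open>W''\<close>, for the velocity \<open>W\<close>, once mixed partials
  are exchanged. So a velocity known at one instant suffices, and the affine family
  \<open>\<gamma> s + t V s\<close> tests a law without any solution of the evolution equation.
  Curves with a prescribed jet are obtained without solving the Frenet system: a tangent is written
  down on the unit sphere and integrated, and the interval is shrunk until curvature and torsion are
  positive. The tangential constant \<open>c1\<close> must vanish by incompatibility. The two
  equations are \<open>h3_\<kappa> = c1 / (2 \<tau>)\<close> and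
  \<open>h3_\<tau> = - h3 / (2 \<tau>)\<close>, subscripts denoting partial derivatives; the mixed
  derivatives they predict are \<open>- c1 / (2 \<tau>^2)\<close> and
  \<open>- c1 / (4 \<tau>^2)\<close>. The proof uses the integrated form of this conflict.\<close>

lemma C_k_on_SucI:
  "(\<And>x. x \<in> S \<Longrightarrow> (f has_derivative D x) (at x)) \<Longrightarrow> (\<And>v. C_k_on k S (\<lambda>x. D x v)) \<Longrightarrow>
    C_k_on (Suc k) S f"
  by auto

lemma C_k_on_SucE:
  assumes "C_k_on (Suc k) S f"
  obtains D where "\<And>x. x \<in> S \<Longrightarrow> (f has_derivative D x) (at x)" "\<And>v. C_k_on k S (\<lambda>x. D x v)"
  using assms by auto

declare C_k_on.simps(2) [simp del]

lemma C_k_on_const: "C_k_on k S (\<lambda>x. c)"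
  by (induction k arbitrary: c) (auto intro!: C_k_on_SucI[where D="\<lambda>_ _. 0"])

lemma C_k_on_pred: "C_k_on (Suc k) S f \<Longrightarrow> C_k_on k S f"
proof (induction k arbitrary: f)
  case 0
  then show ?case
    by (auto elim!: C_k_on_SucE intro!: continuous_at_imp_continuous_on has_derivative_continuous)
next
  case (Suc k)
  obtain D where D: "\<And>x. x \<in> S \<Longrightarrow> (f has_derivative D x) (at x)" "\<And>v. C_k_on (Suc k) S (\<lambda>x. D x v)"
    using Suc.prems by (rule C_k_on_SucE) blast
  show ?case
    by (rule C_k_on_SucI[OF D(1) Suc.IH[OF D(2)]])
qed

text \<open>The derivative at a point depends on values nearby, so openness lets the same witness
  \<open>D\<close> serve for \<open>g\<close>.\<close>

lemma C_k_on_cong: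
  assumes "C_k_on k S f" "open S" "\<And>x. x \<in> S \<Longrightarrow> f x = g x"
  shows "C_k_on k S g"
proof (cases k)
  case 0
  then show ?thesis
    using assms by (auto cong: continuous_on_cong)
next
  case (Suc m)
  obtain D where D: "\<And>x. x \<in> S \<Longrightarrow> (f has_derivative D x) (at x)" "\<And>v. C_k_on m S (\<lambda>x. D x v)"
    using assms(1) unfolding Suc by (rule C_k_on_SucE) blast
  have "(g has_derivative D x) (at x)" if "x \<in> S" for x
    using has_derivative_transform_within_open[OF D(1) assms(2) that] assms(3) that by blast
  then show ?thesis
    unfolding Suc by (rule C_k_on_SucI[OF _ D(2)])
qed

lemma C_k_on_linear:
  assumes "bounded_linear L" "C_k_on k S f"
  shows "C_k_on k S (\<lambda>x. L (f x))"
  using assms(2)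
proof (induction k arbitrary: f)
  case 0
  then show ?case
    using assms(1) by (simp add: bounded_linear.continuous_on)
next
  case (Suc k)
  obtain D where D: "\<And>x. x \<in> S \<Longrightarrow> (f has_derivative D x) (at x)" "\<And>v. C_k_on k S (\<lambda>x. D x v)"
    using Suc.prems by (rule C_k_on_SucE) blast
  show ?case
    by (rule C_k_on_SucI[OF bounded_linear.has_derivative[OF assms(1) D(1)] Suc.IH[OF D(2)]])
qed

lemma C_k_on_add:
  assumes "C_k_on k S f" "C_k_on k S g"
  shows "C_k_on k S (\<lambda>x. f x + g x)"
  using assms
proof (induction k arbitrary: f g)
  case 0
  then show ?case
    by (simp add: continuous_on_add)
next
  case (Suc k)
  obtain D where D: "\<And>x. x \<in> S \<Longrightarrow> (f has_derivative D x) (at x)" "\<And>v. C_k_on k S (\<lambda>x. D x v)"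
    using Suc.prems(1) by (rule C_k_on_SucE) blast
  obtain E where E: "\<And>x. x \<in> S \<Longrightarrow> (g has_derivative E x) (at x)" "\<And>v. C_k_on k S (\<lambda>x. E x v)"
    using Suc.prems(2) by (rule C_k_on_SucE) blast
  show ?case
    by (rule C_k_on_SucI[OF has_derivative_add[OF D(1) E(1)] Suc.IH[OF D(2) E(2)]])
qed

text \<open>The product rule leaves sums of \<open>B\<close> applied to one derivative and one
  undifferentiated factor; the latter is lowered to class \<open>k\<close> by
  \<open>C_k_on_pred\<close> before the induction hypothesis applies.\<close>

lemma C_k_on_bilinear:
  assumes "bounded_bilinear B" "C_k_on k S f" "C_k_on k S g"
  shows "C_k_on k S (\<lambda>x. B (f x) (g x))"
  using assms(2,3)
proof (induction k arbitrary: f g)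
  case 0
  then show ?case
    using assms(1) by (simp add: bounded_bilinear.continuous_on)
next
  case (Suc k)
  obtain D where D: "\<And>x. x \<in> S \<Longrightarrow> (f has_derivative D x) (at x)" "\<And>v. C_k_on k S (\<lambda>x. D x v)"
    using Suc.prems(1) by (rule C_k_on_SucE) blast
  obtain E where E: "\<And>x. x \<in> S \<Longrightarrow> (g has_derivative E x) (at x)" "\<And>v. C_k_on k S (\<lambda>x. E x v)"
    using Suc.prems(2) by (rule C_k_on_SucE) blast
  show ?case
    by (rule C_k_on_SucI[OF bounded_bilinear.FDERIV[OF assms(1) D(1) E(1)]], assumption, assumption)
      (intro C_k_on_add Suc.IH D E C_k_on_pred[OF Suc.prems(1)] C_k_on_pred[OF Suc.prems(2)])
qed

lemmas C_k_on_mult = C_k_on_bilinear[OF bounded_bilinear_mult]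
lemmas C_k_on_scaleR = C_k_on_bilinear[OF bounded_bilinear_scaleR]

lemma C_k_on_sum:
  assumes "\<And>i. i \<in> A \<Longrightarrow> C_k_on k S (f i)"
  shows "C_k_on k S (\<lambda>x. \<Sum>i\<in>A. f i x)"
  using assms by (induction A rule: infinite_finite_induct) (auto intro: C_k_on_add C_k_on_const)

lemma C_k_on_pair:
  assumes "C_k_on k S f" "C_k_on k S g"
  shows "C_k_on k S (\<lambda>x. (f x, g x))"
proof -
  have "C_k_on k S (\<lambda>x. (f x, 0) + (0, g x))"
    by (intro C_k_on_add C_k_on_linear[of "\<lambda>y. (y, 0)"] C_k_on_linear[of "\<lambda>y. (0, y)"] assms
        bounded_linear_Pair bounded_linear_ident bounded_linear_zero)
  then show ?thesis
    by simp
qed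

text \<open>The chain rule evaluates the derivative of \<open>g\<close> in the moving direction
  \<open>E x v\<close>, whereas \<open>C_k_on\<close> controls fixed directions only. Expanding
  \<open>E x v\<close> in the finite basis turns the derivative into a sum of products of class
  \<open>k\<close>.\<close>

lemma C_k_on_compose:
  fixes f :: "'a::real_normed_vector \<Rightarrow> 'b::euclidean_space"
  assumes "C_k_on k T g" "C_k_on k S f" "f ` S \<subseteq> T"
  shows "C_k_on k S (\<lambda>x. g (f x))"
  using assms(1,2)
proof (induction k arbitrary: g)
  case 0
  then show ?case
    using assms(3) by (auto intro: continuous_on_compose2)
next
  case (Suc k)
  obtain D where D: "\<And>x. x \<in> T \<Longrightarrow> (g has_derivative D x) (at x)" "\<And>v. C_k_on k T (\<lambda>x. D x v)"
    using Suc.prems(1) by (rule C_k_on_SucE) blast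
  obtain E where E: "\<And>x. x \<in> S \<Longrightarrow> (f has_derivative E x) (at x)" "\<And>v. C_k_on k S (\<lambda>x. E x v)"
    using Suc.prems(2) by (rule C_k_on_SucE) blast
  have lin: "linear (D (f x))" if "x \<in> S" for x
    using assms(3) that by (intro has_derivative_linear[OF D(1)]) auto
  have expand: "D (f x) (E x v) = (\<Sum>b\<in>Basis. (E x v \<bullet> b) *\<^sub>R D (f x) b)" if "x \<in> S" for x v
    using linear_sum[OF lin[OF that], of "\<lambda>b. (E x v \<bullet> b) *\<^sub>R b" Basis]
    by (simp add: euclidean_representation linear_scale[OF lin[OF that]])
  define D' where "D' x v = (\<Sum>b\<in>Basis. (E x v \<bullet> b) *\<^sub>R D (f x) b)" for x v
  have "C_k_on k S (\<lambda>x. D' x v)" for v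
    unfolding D'_def
    by (intro C_k_on_sum C_k_on_scaleR Suc.IH D(2) C_k_on_pred[OF Suc.prems(2)]
        C_k_on_linear[OF bounded_linear_inner_left E(2)])
  moreover have "((\<lambda>x. g (f x)) has_derivative D' x) (at x)" if "x \<in> S" for x
  proof -
    have "((\<lambda>x. g (f x)) has_derivative (\<lambda>v. D (f x) (E x v))) (at x)"
      using assms(3) that by (intro has_derivative_compose[OF E(1) D(1)]) auto
    then show ?thesis
      using expand[OF that] by (simp add: D'_def[abs_def])
  qed
  ultimately show ?case
    by (intro C_k_on_SucI[where D=D'])
qed

text \<open>The function reappears in its own derivative, there needed only in class
  \<open>k\<close>, which is what the induction hypothesis supplies. The square root below works the
  same way.\<close>

lemma C_k_on_inverse:
  fixes f :: "'a::real_normed_vector \<Rightarrow> real"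
  assumes "C_k_on k S f" "\<And>x. x \<in> S \<Longrightarrow> f x \<noteq> 0"
  shows "C_k_on k S (\<lambda>x. inverse (f x))"
  using assms(1)
proof (induction k)
  case 0
  then show ?case
    using assms(2) by (simp add: continuous_on_inverse)
next
  case (Suc k)
  obtain D where D: "\<And>x. x \<in> S \<Longrightarrow> (f has_derivative D x) (at x)" "\<And>v. C_k_on k S (\<lambda>x. D x v)"
    using Suc.prems(1) by (rule C_k_on_SucE) blast
  note IH = Suc.IH[OF C_k_on_pred[OF Suc.prems]]
  have "C_k_on k S (\<lambda>x. (- 1) * (inverse (f x) * D x v * inverse (f x)))" for v
    by (intro C_k_on_mult IH D(2) C_k_on_const)
  then show ?case
    by (intro C_k_on_SucI[OF Deriv.has_derivative_inverse[OF assms(2) D(1)]]) simp_all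
qed

lemma C_k_on_sqrt:
  fixes f :: "'a::real_normed_vector \<Rightarrow> real"
  assumes "C_k_on k S f" "\<And>x. x \<in> S \<Longrightarrow> f x > 0"
  shows "C_k_on k S (\<lambda>x. sqrt (f x))"
  using assms(1)
proof (induction k)
  case 0
  then show ?case
    by (simp add: continuous_on_real_sqrt)
next
  case (Suc k)
  obtain D where D: "\<And>x. x \<in> S \<Longrightarrow> (f has_derivative D x) (at x)" "\<And>v. C_k_on k S (\<lambda>x. D x v)"
    using Suc.prems(1) by (rule C_k_on_SucE) blast
  note IH = Suc.IH[OF C_k_on_pred[OF Suc.prems]]
  have "C_k_on k S (\<lambda>x. inverse (sqrt (f x)) * (1/2) * D x v)" for v
    using assms(2) by (intro C_k_on_mult C_k_on_inverse IH D(2) C_k_on_const) fastforce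
  moreover have "((\<lambda>x. sqrt (f x)) has_derivative (\<lambda>v. inverse (sqrt (f x)) * (1/2) * D x v)) (at x)"
    if "x \<in> S" for x
    by (rule has_derivative_eq_rhs[OF has_derivative_real_sqrt[OF assms(2)[OF that] D(1)[OF that]]])
      (simp add: fun_eq_iff)
  ultimately show ?case
    by (intro C_k_on_SucI[where D="\<lambda>x v. inverse (sqrt (f x)) * (1/2) * D x v"])
qed

text \<open>Each function occurs in the derivative of the other, hence the joint induction.\<close>

lemma C_k_on_sin_cos:
  fixes f :: "'a::real_normed_vector \<Rightarrow> real"
  assumes "C_k_on k S f"
  shows "C_k_on k S (\<lambda>x. sin (f x)) \<and> C_k_on k S (\<lambda>x. cos (f x))"
  using assms
proof (induction k)
  case 0
  then show ?case
    by (simp add: continuous_on_sin continuous_on_cos)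
next
  case (Suc k)
  obtain D where D: "\<And>x. x \<in> S \<Longrightarrow> (f has_derivative D x) (at x)" "\<And>v. C_k_on k S (\<lambda>x. D x v)"
    using Suc.prems(1) by (rule C_k_on_SucE) blast
  have IH: "C_k_on k S (\<lambda>x. sin (f x))" "C_k_on k S (\<lambda>x. cos (f x))"
    using Suc.IH[OF C_k_on_pred[OF Suc.prems]] by auto
  have smooth: "C_k_on k S (\<lambda>x. D x v * cos (f x))" "C_k_on k S (\<lambda>x. D x v * ((- 1) * sin (f x)))" for v
    by (intro C_k_on_mult C_k_on_const IH D(2))+
  have "((\<lambda>x. sin (f x)) has_derivative (\<lambda>v. D x v * cos (f x))) (at x)"
    "((\<lambda>x. cos (f x)) has_derivative (\<lambda>v. D x v * ((- 1) * sin (f x)))) (at x)" if "x \<in> S" for x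
    using has_derivative_sin[OF D(1)[OF that]] has_derivative_cos[OF D(1)[OF that]] by simp_all
  then show ?case
    by (intro conjI C_k_on_SucI[OF _ smooth(1)] C_k_on_SucI[OF _ smooth(2)])
qed

section \<open>Closure properties and derivatives of smooth functions\<close>

lemma smooth_on_const [simp, intro]: "smooth_on S (\<lambda>x. c)"
  by (simp add: smooth_on_def C_k_on_const)

lemma smooth_on_ident [simp, intro]: "smooth_on S (\<lambda>x. x)"
proof -
  have "C_k_on k S (\<lambda>x::'a. x)" for k
    by (cases k) (auto intro!: C_k_on_SucI[where D="\<lambda>_ v. v"] C_k_on_const)
  then show ?thesis
    by (simp add: smooth_on_def)
qed

lemma smooth_on_cong:
  "smooth_on S f \<Longrightarrow> open S \<Longrightarrow> (\<And>x. x \<in> S \<Longrightarrow> f x = g x) \<Longrightarrow> smooth_on S g"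
  unfolding smooth_on_def by (blast intro: C_k_on_cong)

lemma C_k_on_subset: "C_k_on k S f \<Longrightarrow> T \<subseteq> S \<Longrightarrow> C_k_on k T f"
proof (induction k arbitrary: f)
  case (Suc k)
  obtain D where D: "\<And>x. x \<in> S \<Longrightarrow> (f has_derivative D x) (at x)" "\<And>v. C_k_on k S (\<lambda>x. D x v)"
    using Suc.prems(1) by (rule C_k_on_SucE) blast
  show ?case
    using D Suc by (intro C_k_on_SucI[where D=D]) auto
qed (auto intro: continuous_on_subset)

lemma smooth_on_subset: "smooth_on S f \<Longrightarrow> T \<subseteq> S \<Longrightarrow> smooth_on T f"
  unfolding smooth_on_def by (blast intro: C_k_on_subset)

lemma smooth_on_linear: "bounded_linear L \<Longrightarrow> smooth_on S f \<Longrightarrow> smooth_on S (\<lambda>x. L (f x))"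
  unfolding smooth_on_def by (blast intro: C_k_on_linear)

lemma smooth_on_add: "smooth_on S f \<Longrightarrow> smooth_on S g \<Longrightarrow> smooth_on S (\<lambda>x. f x + g x)"
  unfolding smooth_on_def by (blast intro: C_k_on_add)

lemma smooth_on_bilinear:
  "bounded_bilinear B \<Longrightarrow> smooth_on S f \<Longrightarrow> smooth_on S g \<Longrightarrow> smooth_on S (\<lambda>x. B (f x) (g x))"
  unfolding smooth_on_def by (blast intro: C_k_on_bilinear)

lemmas smooth_on_mult = smooth_on_bilinear[OF bounded_bilinear_mult]
lemmas smooth_on_scaleR = smooth_on_bilinear[OF bounded_bilinear_scaleR]
lemmas smooth_on_inner = smooth_on_bilinear[OF bounded_bilinear_inner]
lemmas smooth_on_minus = smooth_on_linear[OF bounded_linear_minus[OF bounded_linear_ident]]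

lemma bounded_bilinear_cross3: "bounded_bilinear cross3"
  using bilinear_cross bilinear_conv_bounded_bilinear by blast

lemmas smooth_on_cross3 = smooth_on_bilinear[OF bounded_bilinear_cross3]

lemma smooth_on_pair: "smooth_on S f \<Longrightarrow> smooth_on S g \<Longrightarrow> smooth_on S (\<lambda>x. (f x, g x))"
  unfolding smooth_on_def by (blast intro: C_k_on_pair)

lemma smooth_on_compose:
  fixes f :: "'a::real_normed_vector \<Rightarrow> 'b::euclidean_space"
  shows "smooth_on T g \<Longrightarrow> smooth_on S f \<Longrightarrow> f ` S \<subseteq> T \<Longrightarrow> smooth_on S (\<lambda>x. g (f x))"
  unfolding smooth_on_def by (blast intro: C_k_on_compose)

lemma smooth_on_inverse:
  fixes f :: "'a::real_normed_vector \<Rightarrow> real"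
  shows "smooth_on S f \<Longrightarrow> (\<And>x. x \<in> S \<Longrightarrow> f x \<noteq> 0) \<Longrightarrow> smooth_on S (\<lambda>x. inverse (f x))"
  unfolding smooth_on_def by (blast intro: C_k_on_inverse)

lemma smooth_on_sqrt:
  fixes f :: "'a::real_normed_vector \<Rightarrow> real"
  shows "smooth_on S f \<Longrightarrow> (\<And>x. x \<in> S \<Longrightarrow> f x > 0) \<Longrightarrow> smooth_on S (\<lambda>x. sqrt (f x))"
  unfolding smooth_on_def by (blast intro: C_k_on_sqrt)

lemma smooth_on_sin_cos:
  fixes f :: "'a::real_normed_vector \<Rightarrow> real"
  assumes "smooth_on S f"
  shows "smooth_on S (\<lambda>x. sin (f x))" "smooth_on S (\<lambda>x. cos (f x))"
  using assms C_k_on_sin_cos unfolding smooth_on_def by blast+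

lemma smooth_on_norm:
  fixes f :: "'a::real_normed_vector \<Rightarrow> 'b::real_inner"
  assumes "smooth_on S f" "\<And>x. x \<in> S \<Longrightarrow> f x \<noteq> 0"
  shows "smooth_on S (\<lambda>x. norm (f x))"
  unfolding norm_eq_sqrt_inner using assms by (intro smooth_on_sqrt smooth_on_inner) auto

lemma smooth_onI:
  assumes "\<And>x. x \<in> S \<Longrightarrow> (f has_derivative D x) (at x)" "\<And>v. smooth_on S (\<lambda>x. D x v)"
  shows "smooth_on S f"
proof -
  have "C_k_on (Suc k) S f" for k
    using assms by (intro C_k_on_SucI[where D=D]) (simp_all add: smooth_on_def)
  then show ?thesis
    by (simp add: smooth_on_def C_k_on_pred)
qed

lemma smooth_on_has_derivative:
  assumes "smooth_on S f" "x \<in> S"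
  shows "(f has_derivative frechet_derivative f (at x)) (at x)"
proof -
  have "C_k_on (Suc 0) S f"
    using assms(1) unfolding smooth_on_def by blast
  then obtain D where "(f has_derivative D x) (at x)"
    by (rule C_k_on_SucE) (use assms(2) in blast)
  then show ?thesis
    using differentiableI frechet_derivative_works by blast
qed

text \<open>The witness \<open>D\<close> inside \<open>C_k_on\<close> may change with
  \<open>k\<close>; uniqueness of the derivative identifies all of them on \<open>S\<close> with one
  function.\<close>

lemma smooth_on_frechet_derivative:
  assumes "smooth_on S f" "open S"
  shows "smooth_on S (\<lambda>x. frechet_derivative f (at x) v)"
  unfolding smooth_on_def
proof
  fix k
  have "C_k_on (Suc k) S f"
    using assms(1) unfolding smooth_on_def by blast
  then obtain D where D: "\<And>x. x \<in> S \<Longrightarrow> (f has_derivative D x) (at x)" "\<And>v. C_k_on k S (\<lambda>x. D x v)"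
    by (rule C_k_on_SucE) blast
  have "D x v = frechet_derivative f (at x) v" if "x \<in> S" for x
    using frechet_derivative_at[OF D(1)[OF that]] by simp
  then show "C_k_on k S (\<lambda>x. frechet_derivative f (at x) v)"
    by (intro C_k_on_cong[OF D(2) assms(2)])
qed

lemma smooth_on_has_vector_derivative:
  fixes f :: "real \<Rightarrow> 'a::real_normed_vector"
  assumes "smooth_on S f" "x \<in> S"
  shows "(f has_vector_derivative vector_derivative f (at x)) (at x)"
  using differentiableI[OF smooth_on_has_derivative[OF assms]] by (simp only: vector_derivative_works)

lemma smooth_on_vector_derivative:
  fixes f :: "real \<Rightarrow> 'a::real_normed_vector"
  assumes "smooth_on S f" "open S"
  shows "smooth_on S (\<lambda>x. vector_derivative f (at x))"
proof -
  have "frechet_derivative f (at x) 1 = vector_derivative f (at x)" if "x \<in> S" for x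
  proof -
    have 1: "(f has_derivative (\<lambda>h. h *\<^sub>R vector_derivative f (at x))) (at x)"
      using smooth_on_has_vector_derivative[OF assms(1) that] 
      by (simp only: has_vector_derivative_def)
    have 2: "(\<lambda>h. h *\<^sub>R vector_derivative f (at x)) = frechet_derivative f (at x)"
      by (rule frechet_derivative_at[OF 1])
    show ?thesis
      unfolding 2[symmetric] by (rule scaleR_one)
  qed
  then show ?thesis
    by (rule smooth_on_cong[OF smooth_on_frechet_derivative[OF assms] assms(2)])
qed
lemma smooth_on_antiderivative:
  fixes f :: "real \<Rightarrow> 'a::real_normed_vector"
  assumes "smooth_on S f" "\<And>x. x \<in> S \<Longrightarrow> (F has_vector_derivative f x) (at x)"
  shows "smooth_on S F"
proof (rule smooth_onI[where D="\<lambda>x v. v *\<^sub>R f x"])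
  show "(F has_derivative (\<lambda>v. v *\<^sub>R f x)) (at x)" if "x \<in> S" for x
    using assms(2)[OF that] by (simp only: has_vector_derivative_def)
  show "smooth_on S (\<lambda>x. v *\<^sub>R f x)" for v
    by (intro smooth_on_scaleR assms(1) smooth_on_const)
qed

lemma smooth_on_imp_continuous_on: "smooth_on S f \<Longrightarrow> continuous_on S f"
  unfolding smooth_on_def using C_k_on.simps(1) by blast



section \<open>Partial derivatives of functions of two real variables\<close>

definition partial_fst :: "(real \<times> real \<Rightarrow> 'a::real_normed_vector) \<Rightarrow> real \<times> real \<Rightarrow> 'a" where
  "partial_fst F p = frechet_derivative F (at p) (1, 0)"

definition partial_snd :: "(real \<times> real \<Rightarrow> 'a::real_normed_vector) \<Rightarrow> real \<times> real \<Rightarrow> 'a" where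
  "partial_snd F p = frechet_derivative F (at p) (0, 1)"

text \<open>Joint smoothness is immediate because the partials are the total derivative in a fixed
  direction, not derivatives of slices.\<close>

lemma smooth_on_partials:
  assumes "smooth_on U F" "open U"
  shows "smooth_on U (partial_fst F)" "smooth_on U (partial_snd F)"
  unfolding partial_fst_def[abs_def] partial_snd_def[abs_def]
  by (intro smooth_on_frechet_derivative assms)+

lemma has_vector_derivative_fst:
  fixes F :: "real \<times> real \<Rightarrow> 'a::real_normed_vector"
  assumes "smooth_on U F" "(s, t) \<in> U"
  shows "((\<lambda>s. F (s, t)) has_vector_derivative partial_fst F (s, t)) (at s)"
proof -
  let ?D = "frechet_derivative F (at (s, t))"
  have D: "(F has_derivative ?D) (at (s, t))"
    by (rule smooth_on_has_derivative[OF assms])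
  have "((\<lambda>s. F (s, t)) has_derivative (\<lambda>h. ?D (h, 0))) (at s)"
    by (rule has_derivative_compose[where f="\<lambda>s. (s, t)", OF _ D])
      (intro has_derivative_Pair has_derivative_ident has_derivative_const)
  moreover have "(\<lambda>h. ?D (h, 0)) = (\<lambda>h. h *\<^sub>R ?D (1, 0))"
  proof
    show "?D (h, 0) = h *\<^sub>R ?D (1, 0)" for h
      using linear_scale[OF has_derivative_linear[OF D], of h "(1, 0)"] by simp
  qed
  ultimately show ?thesis
    by (simp only: has_vector_derivative_def partial_fst_def)
qed

lemma has_vector_derivative_snd:
  fixes F :: "real \<times> real \<Rightarrow> 'a::real_normed_vector"
  assumes "smooth_on U F" "(s, t) \<in> U"
  shows "((\<lambda>t. F (s, t)) has_vector_derivative partial_snd F (s, t)) (at t)"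
proof -
  let ?D = "frechet_derivative F (at (s, t))"
  have D: "(F has_derivative ?D) (at (s, t))"
    by (rule smooth_on_has_derivative[OF assms])
  have "((\<lambda>t. F (s, t)) has_derivative (\<lambda>h. ?D (0, h))) (at t)"
    by (rule has_derivative_compose[where f="\<lambda>t. (s, t)", OF _ D])
      (intro has_derivative_Pair has_derivative_ident has_derivative_const)
  moreover have "(\<lambda>h. ?D (0, h)) = (\<lambda>h. h *\<^sub>R ?D (0, 1))"
  proof
    show "?D (0, h) = h *\<^sub>R ?D (0, 1)" for h
      using linear_scale[OF has_derivative_linear[OF D], of h "(0, 1)"] by simp
  qed
  ultimately show ?thesis
    by (simp only: has_vector_derivative_def partial_snd_def)
qed

text \<open>Differentiating \<open>F (s, t) - F (a, t) = \<integral> \<partial>\<^sub>1F\<close> under the integral sign.\<close>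

lemma mixed_partials_commute:
  fixes F :: "real \<times> real \<Rightarrow> 'a::banach"
  assumes "smooth_on U F" "open U" "(s, t) \<in> U"
  shows "partial_snd (partial_fst F) (s, t) = partial_fst (partial_snd F) (s, t)"
proof -
  define P where "P = partial_fst F"
  define V where "V = partial_snd F"
  define M where "M = partial_snd P"
  have P: "smooth_on U P" and V: "smooth_on U V"
    unfolding P_def V_def by (intro smooth_on_partials assms(1,2))+
  have M: "smooth_on U M"
    unfolding M_def by (intro smooth_on_partials P assms(2))
  obtain A B where AB: "open A" "open B" "s \<in> A" "t \<in> B" "A \<times> B \<subseteq> U"
    by (rule open_prod_elim[OF assms(2,3)]) (metis mem_Times_iff fst_conv snd_conv)
  obtain r1 where r1: "r1 > 0" "cball s r1 \<subseteq> A"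
    using AB open_contains_cball by blast
  obtain r2 where r2: "r2 > 0" "cball t r2 \<subseteq> B"
    using AB open_contains_cball by blast
  define a b where "a = s - r1" and "b = s + r1"
  have box: "(u, w) \<in> U" if "u \<in> {a..b}" "w \<in> cball t r2" for u w
  proof -
    have "u \<in> cball s r1"
      using that(1) by (auto simp: a_def b_def dist_real_def)
    then show ?thesis
      using that(2) r1(2) r2(2) AB(5) by blast
  qed
  have tc: "t \<in> interior (cball t r2)"
    using r2(1) by simp
  have int_M: "V (u, t) - V (a, t) = integral {a..u} (\<lambda>u. M (u, t))" if u: "u \<in> {a..b}" for u
  proof -
    have cont: "continuous_on (cball t r2 \<times> cbox a u) (\<lambda>(w, x). G (x, w))"
      if "smooth_on U G" for G :: "real \<times> real \<Rightarrow> 'a"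
    proof -
      have "continuous_on (cball t r2 \<times> cbox a u) (\<lambda>q. G (snd q, fst q))"
        using box u
        by (intro continuous_on_compose2[OF smooth_on_imp_continuous_on[OF that]] continuous_intros) auto
      then show ?thesis
        by (simp add: case_prod_unfold)
    qed
    have deriv: "((\<lambda>w. P (x, w)) has_vector_derivative M (x, w)) (at w within cball t r2)"
      if "w \<in> cball t r2" "x \<in> cbox a u" for w x
      unfolding M_def using that u
      by (intro has_vector_derivative_at_within[OF has_vector_derivative_snd[OF P]] box) auto
    have integrable: "(\<lambda>x. P (x, w)) integrable_on cbox a u" if "w \<in> cball t r2" for w
    proof (intro integrable_continuous continuous_on_compose2[OF smooth_on_imp_continuous_on[OF P]])
      show "(\<lambda>x. (x, w)) ` cbox a u \<subseteq> U"
        using box[OF _ that] u by auto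
    qed (intro continuous_intros)
    have int_P: "integral (cbox a u) (\<lambda>x. P (x, w)) = F (u, w) - F (a, w)" if "w \<in> cball t r2" for w
    proof -
      have "((\<lambda>x. P (x, w)) has_integral F (u, w) - F (a, w)) {a..u}"
      proof (rule fundamental_theorem_of_calculus)
        show "a \<le> u"
          using u by simp
        show "((\<lambda>x. F (x, w)) has_vector_derivative P (x, w)) (at x within {a..u})"
          if "x \<in> {a..u}" for x
          unfolding P_def
          using u that by (intro has_vector_derivative_at_within[OF has_vector_derivative_fst[OF assms(1)]]
              box[OF _ \<open>w \<in> cball t r2\<close>]) auto
      qed
      then show ?thesis
        by (simp add: integral_unique)
    qed
    have "((\<lambda>w. integral (cbox a u) (\<lambda>x. P (x, w))) has_vector_derivative
        integral (cbox a u) (\<lambda>x. M (x, t))) (at t within cball t r2)"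
      by (rule leibniz_rule_vector_derivative[OF deriv integrable cont[OF M]])
        (use r2 in \<open>auto intro: convex_cball\<close>)
    then have "((\<lambda>w. integral (cbox a u) (\<lambda>x. P (x, w))) has_vector_derivative
        integral (cbox a u) (\<lambda>x. M (x, t))) (at t)"
      using at_within_interior[OF tc] by simp
    then have "((\<lambda>w. F (u, w) - F (a, w)) has_vector_derivative integral (cbox a u) (\<lambda>x. M (x, t))) (at t)"
      by (rule has_vector_derivative_transform_within_open[where S="ball t r2"])
        (use r2 int_P in auto)
    moreover have "((\<lambda>w. F (u, w) - F (a, w)) has_vector_derivative V (u, t) - V (a, t)) (at t)"
      unfolding V_def using u r1 r2
      by (intro has_vector_derivative_diff has_vector_derivative_snd[OF assms(1)] box)
        (auto simp: a_def b_def)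
    ultimately show ?thesis
      using vector_derivative_unique_at by (metis cbox_interval)
  qed
  have s: "s \<in> {a..b}" "s \<in> interior {a..b}"
    using r1 by (auto simp: a_def b_def)
  \<comment> \<open>Differentiating \<open>int_M\<close> in its upper limit recovers the integrand
    \<open>M\<close>.\<close>
  have "((\<lambda>u. integral {a..u} (\<lambda>u. M (u, t))) has_vector_derivative M (s, t)) (at s within {a..b})"
  proof (rule integral_has_vector_derivative[OF _ s(1)])
    show "continuous_on {a..b} (\<lambda>u. M (u, t))"
      using box r2(1)
      by (intro continuous_on_compose2[OF smooth_on_imp_continuous_on[OF M]] continuous_intros) auto
  qed
  then have "((\<lambda>u. V (u, t) - V (a, t)) has_vector_derivative M (s, t)) (at s within {a..b})"
    by (rule has_vector_derivative_transform[OF s(1), rotated]) (use int_M in simp)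
  then have "((\<lambda>u. V (u, t) - V (a, t)) has_vector_derivative M (s, t)) (at s)"
    using at_within_interior[OF s(2)] by simp
  then have "((\<lambda>u. V (u, t) - V (a, t) + V (a, t)) has_vector_derivative M (s, t) + 0) (at s)"
    by (intro has_vector_derivative_add has_vector_derivative_const)
  then have "((\<lambda>u. V (u, t)) has_vector_derivative M (s, t)) (at s)"
    by simp
  then have "M (s, t) = partial_fst V (s, t)"
    using has_vector_derivative_fst[OF V assms(3)] by (rule vector_derivative_unique_at)
  then show ?thesis
    unfolding M_def P_def V_def .
qed


section \<open>Frenet--Serret equations\<close>

lemma smooth_on_arc_deriv:
  assumes "open I" "smooth_on I \<gamma>" "\<And>s. s \<in> I \<Longrightarrow> speed \<gamma> s > 0" "smooth_on I F"
  shows "smooth_on I (speed \<gamma>)" "smooth_on I (arc_deriv \<gamma> F)"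
proof -
  have "smooth_on I (\<lambda>s. norm (vector_derivative \<gamma> (at s)))"
    using assms(3) by (intro smooth_on_norm smooth_on_vector_derivative assms) (force simp: speed_def)
  then show *: "smooth_on I (speed \<gamma>)"
    by (simp add: speed_def[abs_def])
  have "smooth_on I (\<lambda>s. inverse (speed \<gamma> s) *\<^sub>R vector_derivative F (at s))"
    using assms(3) by (intro smooth_on_scaleR smooth_on_inverse * smooth_on_vector_derivative assms) force
  then show "smooth_on I (arc_deriv \<gamma> F)"
    by (simp add: arc_deriv_def[abs_def])
qed

text \<open>Source of the orthogonality relations: it is applied to the constant products
  \<open>T \<bullet> T\<close>, \<open>B \<bullet> B\<close> and
  \<open>T \<bullet> B\<close>.\<close>

lemma vector_derivative_inner_const:
  fixes f g :: "real \<Rightarrow> 'a::real_inner"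
  assumes "open I" "s \<in> I" "\<And>s. s \<in> I \<Longrightarrow> f s \<bullet> g s = c"
    and "(f has_vector_derivative f') (at s)" "(g has_vector_derivative g') (at s)"
  shows "f s \<bullet> g' + f' \<bullet> g s = 0"
proof -
  have "((\<lambda>s. f s \<bullet> g s) has_vector_derivative f s \<bullet> g' + f' \<bullet> g s) (at s)"
    by (rule bounded_bilinear.has_vector_derivative[OF bounded_bilinear_inner assms(4,5)])
  then have "((\<lambda>s. c) has_vector_derivative f s \<bullet> g' + f' \<bullet> g s) (at s)"
    by (rule has_vector_derivative_transform_within_open[OF _ assms(1,2,3)])
  then show ?thesis
    using vector_derivative_unique_at has_vector_derivative_const by blast
qed

text \<open>The speed is only positive, since along an evolving family unit speed has to be derived,
  and that derivation already uses the Frenet equations. They therefore carry the factor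
  \<open>v\<close>.\<close>

locale frenet_curve =
  fixes I :: "real set" and \<gamma> :: "real \<Rightarrow> real^3"
  assumes open_I: "open I" and smooth_curve: "smooth_on I \<gamma>"
    and speed_pos: "\<And>s. s \<in> I \<Longrightarrow> speed \<gamma> s > 0"
    and curvature_pos: "\<And>s. s \<in> I \<Longrightarrow> curvature \<gamma> s > 0"
begin

abbreviation "v \<equiv> speed \<gamma>"
abbreviation "T \<equiv> unit_tangent \<gamma>"
abbreviation "N \<equiv> unit_normal \<gamma>"
abbreviation "B \<equiv> unit_binormal \<gamma>"
abbreviation "\<kappa> \<equiv> curvature \<gamma>"
abbreviation "\<tau> \<equiv> torsion \<gamma>"

lemma smooth_frame: "smooth_on I v" "smooth_on I T" "smooth_on I N" "smooth_on I B"
  and smooth_curvature: "smooth_on I \<kappa>" and smooth_torsion: "smooth_on I \<tau>"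
proof -
  show "smooth_on I v"
    by (rule smooth_on_arc_deriv(1)[OF open_I smooth_curve speed_pos smooth_curve])
  have arc: "smooth_on I (arc_deriv \<gamma> F)" if "smooth_on I F" for F
    by (rule smooth_on_arc_deriv(2)[OF open_I smooth_curve speed_pos that])
  show T: "smooth_on I T"
    unfolding unit_tangent_def by (rule arc[OF smooth_curve])
  have "smooth_on I (\<lambda>s. norm (arc_deriv \<gamma> T s))"
    using curvature_pos by (intro smooth_on_norm arc[OF T]) (force simp: curvature_def)
  then show k: "smooth_on I \<kappa>"
    by (simp add: curvature_def[abs_def])
  have "smooth_on I (\<lambda>s. inverse (\<kappa> s) *\<^sub>R arc_deriv \<gamma> T s)"
    using curvature_pos by (intro smooth_on_scaleR smooth_on_inverse k arc[OF T]) force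
  then show N: "smooth_on I N"
    by (simp add: unit_normal_def[abs_def])
  show B: "smooth_on I B"
    unfolding unit_binormal_def[abs_def] by (intro smooth_on_cross3 T N)
  show "smooth_on I \<tau>"
    unfolding torsion_def[abs_def] by (intro smooth_on_minus smooth_on_inner arc[OF B] N)
qed

lemma T_deriv:
  assumes "s \<in> I"
  shows "(T has_vector_derivative (v s * \<kappa> s) *\<^sub>R N s) (at s)"
proof -
  have "v s * \<kappa> s * (inverse (\<kappa> s) * inverse (v s)) = 1"
    using speed_pos[OF assms] curvature_pos[OF assms] by (simp add: field_simps)
  then show ?thesis
    using smooth_on_has_vector_derivative[OF smooth_frame(2) assms]
    by (simp add: unit_normal_def arc_deriv_def del: mult_scaleR_left)
qed

lemma norm_T: "s \<in> I \<Longrightarrow> norm (T s) = 1"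
  using speed_pos[of s] by (simp add: unit_tangent_def arc_deriv_def speed_def)

lemma norm_N: "s \<in> I \<Longrightarrow> norm (N s) = 1"
  using curvature_pos[of s] by (simp add: unit_normal_def curvature_def)

lemma TT: "s \<in> I \<Longrightarrow> T s \<bullet> T s = 1" and NN: "s \<in> I \<Longrightarrow> N s \<bullet> N s = 1"
  using norm_T norm_N by (simp_all add: norm_eq_1)

text \<open>Differentiating \<open>T \<bullet> T = 1\<close> gives
  \<open>2 v \<kappa> (T \<bullet> N) = 0\<close>.\<close>

lemma TN: "s \<in> I \<Longrightarrow> T s \<bullet> N s = 0"
  using vector_derivative_inner_const[OF open_I _ TT T_deriv T_deriv, of s] speed_pos[of s] curvature_pos[of s]
  by (simp add: inner_commute)

lemma TB: "T s \<bullet> B s = 0" and NB: "N s \<bullet> B s = 0"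
  by (simp_all add: unit_binormal_def dot_cross_self)

lemma BB: "s \<in> I \<Longrightarrow> B s \<bullet> B s = 1"
  using TT[of s] NN[of s] TN[of s] by (simp add: unit_binormal_def dot_cross inner_commute)

lemma N_eq_cross: "s \<in> I \<Longrightarrow> N s = cross3 (B s) (T s)"
  using TT[of s] TN[of s] Lagrange[of "T s" "T s" "N s"]
  by (subst cross_skew) (simp add: unit_binormal_def)

lemma T_eq_cross: "s \<in> I \<Longrightarrow> T s = cross3 (N s) (B s)"
  using NN[of s] TN[of s] Lagrange[of "N s" "T s" "N s"]
  by (simp add: unit_binormal_def inner_commute)

text \<open>\<open>B'\<close> has no \<open>B\<close> component because \<open>B\<close> is a unit
  vector, and no \<open>T\<close> component because \<open>T \<bullet> B = 0\<close> and
  \<open>T'\<close> is parallel to \<open>N\<close>. What remains is its \<open>N\<close> component,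
  which is the torsion by definition.\<close>

lemma B_deriv:
  assumes "s \<in> I"
  shows "(B has_vector_derivative (- (v s * \<tau> s)) *\<^sub>R N s) (at s)"
proof -
  obtain B' where B': "(B has_vector_derivative B') (at s)"
    using smooth_on_has_vector_derivative[OF smooth_frame(4) assms] by blast
  have "B' \<bullet> B s = 0"
    using vector_derivative_inner_const[OF open_I assms BB B' B'] by (simp add: inner_commute)
  have "B' \<bullet> T s = 0"
    using vector_derivative_inner_const[OF open_I assms TB T_deriv[OF assms] B'] NB[of s]
    by (simp add: inner_commute)
  \<comment> \<open>In place of a basis expansion, the double product
    \<open>B \<times> (B' \<times> B)\<close> is computed in two ways: it is \<open>B'\<close>, and
    it is \<open>(B' \<bullet> N) N\<close>.\<close>
  have "cross3 B' (B s) = (B' \<bullet> N s) *\<^sub>R T s"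
    using Lagrange[of B' "T s" "N s"] \<open>B' \<bullet> T s = 0\<close> by (simp add: unit_binormal_def)
  then have "cross3 (B s) (cross3 B' (B s)) = (B' \<bullet> N s) *\<^sub>R N s"
    by (simp add: cross_mult_right N_eq_cross[OF assms, symmetric])
  then have "B' = (B' \<bullet> N s) *\<^sub>R N s"
    using Lagrange[of "B s" B' "B s"] BB[OF assms] \<open>B' \<bullet> B s = 0\<close> by (simp add: inner_commute)
  moreover have "\<tau> s = - (B' \<bullet> N s) / v s"
    using vector_derivative_at[OF B'] by (simp add: torsion_def arc_deriv_def divide_inverse)
  ultimately have "B' = (- (v s * \<tau> s)) *\<^sub>R N s"
    using speed_pos[OF assms] by simp
  with B' show ?thesis
    by simp
qed

text \<open>Product rule for \<open>N = B \<times> T\<close>, using the other two equations.\<close>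

lemma N_deriv:
  assumes "s \<in> I"
  shows "(N has_vector_derivative v s *\<^sub>R (\<tau> s *\<^sub>R B s - \<kappa> s *\<^sub>R T s)) (at s)"
proof -
  have "((\<lambda>s. cross3 (B s) (T s)) has_vector_derivative
      cross3 (B s) ((v s * \<kappa> s) *\<^sub>R N s) + cross3 ((- (v s * \<tau> s)) *\<^sub>R N s) (T s)) (at s)"
    by (rule bounded_bilinear.has_vector_derivative[OF bounded_bilinear_cross3
          B_deriv[OF assms] T_deriv[OF assms]])
  moreover have "cross3 (B s) (N s) = - T s" "cross3 (N s) (T s) = - B s"
    using T_eq_cross[OF assms] cross_skew[of "B s" "N s"] cross_skew[of "N s" "T s"]
    by (simp_all add: unit_binormal_def)
  ultimately have "((\<lambda>s. cross3 (B s) (T s)) has_vector_derivative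
      v s *\<^sub>R (\<tau> s *\<^sub>R B s - \<kappa> s *\<^sub>R T s)) (at s)"
    by (simp add: cross_mult_left cross_mult_right algebra_simps)
  then show ?thesis
    by (rule has_vector_derivative_transform_within_open[OF _ open_I assms]) (simp add: N_eq_cross)
qed

end



section \<open>First variation of speed and curvature\<close>

text \<open>This is the classical \<open>|P \<times> Q| / |P|^3\<close>, with the numerator expanded
  by Lagrange's identity. It holds for every regular parametrization, so it stays available at
  neighbouring times, where unit speed is not known.\<close>

lemma curvature_eq:
  assumes deriv: "((\<lambda>s. vector_derivative \<gamma> (at s)) has_vector_derivative Q) (at s)"
    and P: "P = vector_derivative \<gamma> (at s)" "P \<noteq> 0"
  shows "curvature \<gamma> s = sqrt ((Q \<bullet> Q) / (P \<bullet> P)^2 - (P \<bullet> Q)^2 / (P \<bullet> P)^3)"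
proof -
  define p where "p s = vector_derivative \<gamma> (at s)" for s
  have p: "(p has_vector_derivative Q) (at s)" and ps: "p s = P"
    using deriv P(1) by (simp_all add: p_def[abs_def])
  define r where "r = P \<bullet> P"
  have r: "r > 0"
    using P(2) by (simp add: r_def)
  have sqrt_inv: "inverse (sqrt r) * inverse (sqrt r) = inverse r"
    using r by (metis abs_of_pos inverse_mult_distrib real_sqrt_mult_self)
  have "((\<lambda>s. p s \<bullet> p s) has_vector_derivative P \<bullet> Q + Q \<bullet> P) (at s)"
    using bounded_bilinear.has_vector_derivative[OF bounded_bilinear_inner p p] by (simp add: ps)
  then have "((\<lambda>s. p s \<bullet> p s) has_real_derivative 2 * (P \<bullet> Q)) (at s)"
    by (simp add: has_real_derivative_iff_has_vector_derivative inner_commute)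
  moreover have "((\<lambda>y. inverse (sqrt y)) has_real_derivative - 1 / (2 * r * sqrt r)) (at (p s \<bullet> p s))"
    using r by (auto intro!: derivative_eq_intros simp: ps r_def[symmetric] field_simps)
  ultimately have "((\<lambda>s. inverse (sqrt (p s \<bullet> p s))) has_real_derivative - (P \<bullet> Q) / (r * sqrt r)) (at s)"
    using DERIV_chain2 by fastforce
  from has_vector_derivative_scaleR[OF this p]
  have "((\<lambda>s. inverse (sqrt (p s \<bullet> p s)) *\<^sub>R p s) has_vector_derivative
      inverse (sqrt r) *\<^sub>R Q + (- (P \<bullet> Q) / (r * sqrt r)) *\<^sub>R P) (at s)"
    by (simp add: ps r_def)
  moreover have "unit_tangent \<gamma> = (\<lambda>s. inverse (sqrt (p s \<bullet> p s)) *\<^sub>R p s)"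
    by (simp add: unit_tangent_def arc_deriv_def[abs_def] speed_def norm_eq_sqrt_inner p_def)
  ultimately have "arc_deriv \<gamma> (unit_tangent \<gamma>) s
      = inverse (sqrt r) *\<^sub>R (inverse (sqrt r) *\<^sub>R Q + (- (P \<bullet> Q) / (r * sqrt r)) *\<^sub>R P)"
    using P(1) by (simp add: arc_deriv_def vector_derivative_at speed_def norm_eq_sqrt_inner r_def)
  also have "\<dots> = inverse r *\<^sub>R Q - ((P \<bullet> Q) / r^2) *\<^sub>R P"
    using r sqrt_inv
    by (simp add: scaleR_right_diff_distrib divide_inverse power2_eq_square mult_ac)
  finally have arc: "arc_deriv \<gamma> (unit_tangent \<gamma>) s = inverse r *\<^sub>R Q - ((P \<bullet> Q) / r^2) *\<^sub>R P" .
  have "(inverse r *\<^sub>R Q - ((P \<bullet> Q) / r^2) *\<^sub>R P) \<bullet> (inverse r *\<^sub>R Q - ((P \<bullet> Q) / r^2) *\<^sub>R P)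
      = (inverse r)^2 * (Q \<bullet> Q) - 2 * inverse r * ((P \<bullet> Q) / r^2) * (P \<bullet> Q) + ((P \<bullet> Q) / r^2)^2 * r"
    by (simp add: inner_diff_left inner_diff_right r_def power2_eq_square inner_commute algebra_simps)
  also have "\<dots> = (Q \<bullet> Q) / r^2 - (P \<bullet> Q)^2 / r^3"
    using r by (simp add: field_simps power2_eq_square power3_eq_cube)
  finally show ?thesis
    unfolding curvature_def arc norm_eq_sqrt_inner r_def by simp
qed

locale smooth_family =
  fixes U :: "(real \<times> real) set" and X :: "real \<Rightarrow> real \<Rightarrow> real^3"
  assumes open_U: "open U" and smooth_X: "smooth_on U (\<lambda>(s, t). X s t)"
begin

definition "P = partial_fst (\<lambda>(s, t). X s t)"
definition "V = partial_snd (\<lambda>(s, t). X s t)"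
definition "Q = partial_fst P"

lemma smooth: "smooth_on U P" "smooth_on U V" "smooth_on U Q"
  unfolding P_def V_def Q_def by (intro smooth_on_partials open_U smooth_X)+

lemma open_slice: "open {s. (s, t) \<in> U}" "open {t. (s, t) \<in> U}"
proof -
  have "open ((\<lambda>s. (s, t)) -` U)" "open ((\<lambda>t. (s, t)) -` U)"
    by (intro open_vimage open_U continuous_intros)+
  then show "open {s. (s, t) \<in> U}" "open {t. (s, t) \<in> U}"
    by (simp_all add: vimage_def)
qed

lemma X_deriv:
  assumes "(s, t) \<in> U"
  shows "((\<lambda>s. X s t) has_vector_derivative P (s, t)) (at s)"
    and "((\<lambda>t. X s t) has_vector_derivative V (s, t)) (at t)"
  using has_vector_derivative_fst[OF smooth_X assms] has_vector_derivative_snd[OF smooth_X assms]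
  by (simp_all add: P_def V_def)

lemma slice_deriv:
  assumes "(s, t) \<in> U"
  shows "vector_derivative (\<lambda>s. X s t) (at s) = P (s, t)"
    and "((\<lambda>s. vector_derivative (\<lambda>s. X s t) (at s)) has_vector_derivative Q (s, t)) (at s)"
proof -
  have *: "vector_derivative (\<lambda>s. X s t) (at s) = P (s, t)" if "(s, t) \<in> U" for s
    by (rule vector_derivative_at[OF X_deriv(1)[OF that]])
  then show "vector_derivative (\<lambda>s. X s t) (at s) = P (s, t)"
    using assms .
  have "((\<lambda>s. P (s, t)) has_vector_derivative Q (s, t)) (at s)"
    unfolding Q_def by (rule has_vector_derivative_fst[OF smooth(1) assms])
  then show "((\<lambda>s. vector_derivative (\<lambda>s. X s t) (at s)) has_vector_derivative Q (s, t)) (at s)"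
    by (rule has_vector_derivative_transform_within_open[OF _ open_slice(1)]) (use assms * in auto)
qed

lemma speed_eq: "(s, t) \<in> U \<Longrightarrow> speed (\<lambda>s. X s t) s = norm (P (s, t))"
  by (simp add: speed_def slice_deriv)

text \<open>\<open>W\<close> is known at the single time \<open>t\<close> but for all
  \<open>s\<close> in an open set, so it can be differentiated in \<open>s\<close>; one exchange of
  mixed partials gives the time derivative of \<open>P\<close>, a second one that of
  \<open>Q\<close>.\<close>

lemma velocity_deriv:
  assumes "open I" "I \<times> {t} \<subseteq> U" "s \<in> I"
    and W: "\<And>s. s \<in> I \<Longrightarrow> ((\<lambda>t. X s t) has_vector_derivative W s) (at t)"
  shows "((\<lambda>t. P (s, t)) has_vector_derivative vector_derivative W (at s)) (at t)"
    and "((\<lambda>t. Q (s, t)) has_vector_derivative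
           vector_derivative (\<lambda>s. vector_derivative W (at s)) (at s)) (at t)"
proof -
  have U: "(s, t) \<in> U" if "s \<in> I" for s
    using that assms(2) by blast
  have W_eq: "V (s, t) = W s" if "s \<in> I" for s
    using vector_derivative_unique_at[OF X_deriv(2)[OF U[OF that]] W[OF that]] .
  have W': "vector_derivative W (at s) = partial_snd P (s, t)" if "s \<in> I" for s
  proof -
    have "((\<lambda>s. V (s, t)) has_vector_derivative partial_fst V (s, t)) (at s)"
      by (rule has_vector_derivative_fst[OF smooth(2) U[OF that]])
    then have "(W has_vector_derivative partial_fst V (s, t)) (at s)"
      by (rule has_vector_derivative_transform_within_open[OF _ assms(1) that W_eq])
    then have "vector_derivative W (at s) = partial_fst V (s, t)"
      by (rule vector_derivative_at)
    also have "\<dots> = partial_snd P (s, t)"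
      unfolding V_def P_def by (rule mixed_partials_commute[OF smooth_X open_U U[OF that], symmetric])
    finally show ?thesis .
  qed
  show "((\<lambda>t. P (s, t)) has_vector_derivative vector_derivative W (at s)) (at t)"
    unfolding W'[OF assms(3)] by (rule has_vector_derivative_snd[OF smooth(1) U[OF assms(3)]])
  have "((\<lambda>s. partial_snd P (s, t)) has_vector_derivative partial_fst (partial_snd P) (s, t)) (at s)"
    by (rule has_vector_derivative_fst[OF smooth_on_partials(2)[OF smooth(1) open_U] U[OF assms(3)]])
  then have "((\<lambda>s. vector_derivative W (at s)) has_vector_derivative partial_fst (partial_snd P) (s, t)) (at s)"
    by (rule has_vector_derivative_transform_within_open[OF _ assms(1,3) W'[symmetric]])
  then have "vector_derivative (\<lambda>s. vector_derivative W (at s)) (at s) = partial_fst (partial_snd P) (s, t)"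
    by (rule vector_derivative_at)
  also have "\<dots> = partial_snd Q (s, t)"
    unfolding Q_def by (rule mixed_partials_commute[OF smooth(1) open_U U[OF assms(3)], symmetric])
  finally show "((\<lambda>t. Q (s, t)) has_vector_derivative
      vector_derivative (\<lambda>s. vector_derivative W (at s)) (at s)) (at t)"
    using has_vector_derivative_snd[OF smooth(3) U[OF assms(3)]] by simp
qed

text \<open>The norm of \<open>P\<close> changes at the rate \<open>(P / |P|) \<bullet> P_t\<close>,
  and \<open>P_t = W'\<close>.\<close>

lemma speed_variation:
  assumes "open I" "I \<times> {t} \<subseteq> U" "s \<in> I" "speed (\<lambda>s. X s t) s > 0"
    and "\<And>s. s \<in> I \<Longrightarrow> ((\<lambda>t. X s t) has_vector_derivative W s) (at t)"
  shows "((\<lambda>t. speed (\<lambda>s. X s t) s) has_real_derivative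
           unit_tangent (\<lambda>s. X s t) s \<bullet> vector_derivative W (at s)) (at t)"
proof -
  let ?M = "vector_derivative W (at s)"
  have U: "(s, t) \<in> U"
    using assms(2,3) by blast
  have pos: "P (s, t) \<bullet> P (s, t) > 0"
    using assms(4) speed_eq[OF U] by simp
  have d: "((\<lambda>t. P (s, t)) has_vector_derivative ?M) (at t)"
    by (rule velocity_deriv(1)[OF assms(1-3,5)])
  have "((\<lambda>t. P (s, t) \<bullet> P (s, t)) has_real_derivative 2 * (P (s, t) \<bullet> ?M)) (at t)"
    using bounded_bilinear.has_vector_derivative[OF bounded_bilinear_inner d d]
    by (simp add: has_real_derivative_iff_has_vector_derivative inner_commute)
  from DERIV_chain2[OF DERIV_real_sqrt[OF pos] this]
  have "((\<lambda>t. sqrt (P (s, t) \<bullet> P (s, t))) has_real_derivative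
      inverse (norm (P (s, t))) * (P (s, t) \<bullet> ?M)) (at t)"
    by (simp add: norm_eq_sqrt_inner)
  moreover have "unit_tangent (\<lambda>s. X s t) s = inverse (norm (P (s, t))) *\<^sub>R P (s, t)"
    by (simp add: unit_tangent_def arc_deriv_def speed_eq[OF U] slice_deriv[OF U])
  ultimately have "((\<lambda>t. norm (P (s, t))) has_real_derivative
      unit_tangent (\<lambda>s. X s t) s \<bullet> ?M) (at t)"
    by (simp add: norm_eq_sqrt_inner)
  then show ?thesis
    by (rule has_field_derivative_transform_within_open[OF _ open_slice(2)])
      (use U speed_eq in auto)
qed

lemma frenet_curve_slice:
  assumes "open I" "I \<times> {t} \<subseteq> U"
    and "\<And>s. s \<in> I \<Longrightarrow> speed (\<lambda>s. X s t) s > 0" "\<And>s. s \<in> I \<Longrightarrow> curvature (\<lambda>s. X s t) s > 0"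
  shows "frenet_curve I (\<lambda>s. X s t)"
proof
  have U: "(s, t) \<in> U" if "s \<in> I" for s
    using assms(2) that by blast
  show "smooth_on I (\<lambda>s. X s t)"
    by (rule smooth_on_antiderivative[where f="\<lambda>s. P (s, t)", OF _ X_deriv(1)[OF U]])
      (use U in \<open>auto intro!: smooth_on_compose[OF smooth(1)] smooth_on_pair\<close>)
qed (use assms in auto)

text \<open>With \<open>p = P \<bullet> P\<close>, \<open>q = Q \<bullet> Q\<close>,
  \<open>r = P \<bullet> Q\<close>, the squared curvature is \<open>q / p^2 - r^2 / p^3\<close>. At
  unit speed \<open>p = 1\<close> and \<open>r = 0\<close>, and the last hypothesis gives
  \<open>p_t = 0\<close>; so only \<open>q_t = 2 Q \<bullet> W''\<close> survives, where
  \<open>Q = \<kappa> N\<close>.\<close>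

lemma curvature_variation:
  assumes "open I" "I \<times> {t} \<subseteq> U" "s \<in> I" "arclength_param_on I (\<lambda>s. X s t)"
    and "\<And>s. s \<in> I \<Longrightarrow> curvature (\<lambda>s. X s t) s > 0"
    and W: "\<And>s. s \<in> I \<Longrightarrow> ((\<lambda>t. X s t) has_vector_derivative W s) (at t)"
    and "unit_tangent (\<lambda>s. X s t) s \<bullet> vector_derivative W (at s) = 0"
  shows "((\<lambda>t. curvature (\<lambda>s. X s t) s) has_real_derivative
           unit_normal (\<lambda>s. X s t) s \<bullet> vector_derivative (\<lambda>s. vector_derivative W (at s)) (at s)) (at t)"
proof -
  let ?\<gamma> = "\<lambda>s. X s t"
  let ?M = "vector_derivative W (at s)"
  let ?L = "vector_derivative (\<lambda>s. vector_derivative W (at s)) (at s)"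
  have U: "(s, t) \<in> U" if "s \<in> I" for s
    using assms(2) that by blast
  have speed1: "speed ?\<gamma> s = 1" if "s \<in> I" for s
    using assms(4) that by (simp add: arclength_param_on_def)
  interpret frenet_curve I ?\<gamma>
    by (rule frenet_curve_slice[OF assms(1,2)]) (use speed1 assms(5) in auto)
  have P_eq: "P (s, t) = unit_tangent ?\<gamma> s" if "s \<in> I" for s
    using speed1[OF that] by (simp add: unit_tangent_def arc_deriv_def slice_deriv[OF U[OF that]])
  have Q_eq: "Q (s, t) = curvature ?\<gamma> s *\<^sub>R unit_normal ?\<gamma> s"
  proof -
    have "((\<lambda>s. P (s, t)) has_vector_derivative curvature ?\<gamma> s *\<^sub>R unit_normal ?\<gamma> s) (at s)"
      by (rule has_vector_derivative_transform_within_open[OF _ assms(1,3) P_eq[symmetric]])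
        (use T_deriv[OF assms(3)] speed1[OF assms(3)] in auto)
    then show ?thesis
      using vector_derivative_unique_at[OF has_vector_derivative_fst[OF smooth(1) U[OF assms(3)]]]
      by (simp add: Q_def)
  qed
  let ?p = "\<lambda>t. P (s, t) \<bullet> P (s, t)" and ?q = "\<lambda>t. Q (s, t) \<bullet> Q (s, t)"
    and ?r = "\<lambda>t. P (s, t) \<bullet> Q (s, t)"
  have p: "?p t = 1" and r: "?r t = 0" and q: "?q t = (curvature ?\<gamma> s)^2"
    using TT[OF assms(3)] TN[OF assms(3)] NN[OF assms(3)] P_eq[OF assms(3)] Q_eq
    by (simp_all add: power2_eq_square)
  note dP = velocity_deriv(1)[OF assms(1-3) W] and dQ = velocity_deriv(2)[OF assms(1-3) W]
  have dp: "(?p has_real_derivative 0) (at t)"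
    using bounded_bilinear.has_vector_derivative[OF bounded_bilinear_inner dP dP]
      assms(7) P_eq[OF assms(3)]
    by (simp add: has_real_derivative_iff_has_vector_derivative inner_commute)
  have dq: "(?q has_real_derivative 2 * (Q (s, t) \<bullet> ?L)) (at t)"
    using bounded_bilinear.has_vector_derivative[OF bounded_bilinear_inner dQ dQ]
    by (simp add: has_real_derivative_iff_has_vector_derivative inner_commute)
  \<comment> \<open>Existence is enough: \<open>r\<close> enters squared and vanishes at
    \<open>t\<close>, so the term \<open>2 r r'\<close> is zero.\<close>
  obtain r' where dr: "(?r has_real_derivative r') (at t)"
    using bounded_bilinear.has_vector_derivative[OF bounded_bilinear_inner dP dQ]
    by (auto simp: has_real_derivative_iff_has_vector_derivative)
  have "((\<lambda>t. ?q t / (?p t)^2 - (?r t)^2 / (?p t)^3) has_real_derivative 2 * (Q (s, t) \<bullet> ?L)) (at t)"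
    by (rule derivative_eq_intros dp dq dr refl | use p r in simp)+
  from DERIV_chain2[OF DERIV_real_sqrt this]
  have "((\<lambda>t. sqrt (?q t / (?p t)^2 - (?r t)^2 / (?p t)^3)) has_real_derivative
      inverse (curvature ?\<gamma> s) * (Q (s, t) \<bullet> ?L)) (at t)"
    using curvature_pos[OF assms(3)] p r q by simp
  also have "inverse (curvature ?\<gamma> s) * (Q (s, t) \<bullet> ?L) = unit_normal ?\<gamma> s \<bullet> ?L"
    using curvature_pos[OF assms(3)] by (simp add: Q_eq)
  finally have deriv: "((\<lambda>t. sqrt (?q t / (?p t)^2 - (?r t)^2 / (?p t)^3)) has_real_derivative
      unit_normal ?\<gamma> s \<bullet> ?L) (at t)" .
  \<comment> \<open>The closed formula for the curvature requires \<open>P\<close> to be nonzero,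
    which holds for times near \<open>t\<close>.\<close>
  have "open ({t. (s, t) \<in> U} \<inter> (\<lambda>t. P (s, t)) -` (- {0}))"
    by (intro continuous_open_preimage open_slice(2) open_Compl closed_singleton
        continuous_on_compose2[OF smooth_on_imp_continuous_on[OF smooth(1)]] continuous_intros) auto
  then show ?thesis
    by (rule has_field_derivative_transform_within_open[OF deriv])
      (use U[OF assms(3)] p in \<open>auto simp: curvature_eq[OF slice_deriv(2) slice_deriv(1)[symmetric]]\<close>)
qed

end



section \<open>Variations along the Frenet frame\<close>

context frenet_curve
begin

text \<open>Among the derivatives of the frame only \<open>N'\<close> has a tangential component,
  namely \<open>- v \<kappa>\<close>.\<close>

lemma tangential_variation:
  assumes "s \<in> I"
    and "(g1 has_real_derivative g1') (at s)" "(g2 has_real_derivative g2') (at s)"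
      "(g3 has_real_derivative g3') (at s)"
  shows "T s \<bullet> vector_derivative (\<lambda>s. g1 s *\<^sub>R T s + g2 s *\<^sub>R N s + g3 s *\<^sub>R B s) (at s)
       = g1' - v s * \<kappa> s * g2 s"
proof -
  note frame = T_deriv[OF assms(1)] N_deriv[OF assms(1)] B_deriv[OF assms(1)]
  have "((\<lambda>s. g1 s *\<^sub>R T s + g2 s *\<^sub>R N s + g3 s *\<^sub>R B s) has_vector_derivative
      (g1 s *\<^sub>R (v s * \<kappa> s) *\<^sub>R N s + g1' *\<^sub>R T s)
      + (g2 s *\<^sub>R v s *\<^sub>R (\<tau> s *\<^sub>R B s - \<kappa> s *\<^sub>R T s) + g2' *\<^sub>R N s)
      + (g3 s *\<^sub>R (- (v s * \<tau> s)) *\<^sub>R N s + g3' *\<^sub>R B s)) (at s)"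
    by (intro has_vector_derivative_add has_vector_derivative_scaleR frame assms(2-4))
  then show ?thesis
    using TT[OF assms(1)] TN[OF assms(1)] TB[of s]
    by (simp add: vector_derivative_at inner_add_right inner_diff_right algebra_simps)
qed

text \<open>Here \<open>W' = (c \<kappa> - g \<tau>) N + g' B\<close>. The normal part of
  \<open>W''\<close> consists of the derivative of the first coefficient and of
  \<open>- g' \<tau>\<close> from \<open>B'\<close>; this second occurrence of
  \<open>g' \<tau>\<close> explains the factor 2.\<close>

lemma normal_variation:
  assumes s: "s \<in> I" and unit_speed: "\<And>s. s \<in> I \<Longrightarrow> v s = 1"
    and W: "\<And>s. s \<in> I \<Longrightarrow> W s = c *\<^sub>R T s + g s *\<^sub>R B s"
    and g: "smooth_on I g" "(g has_real_derivative g') (at s)"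
    and \<kappa>': "(\<kappa> has_real_derivative \<kappa>') (at s)" and \<tau>': "(\<tau> has_real_derivative \<tau>') (at s)"
  shows "N s \<bullet> vector_derivative (\<lambda>s. vector_derivative W (at s)) (at s)
       = c * \<kappa>' - 2 * g' * \<tau> s - g s * \<tau>'"
proof -
  define dg where "dg s = vector_derivative g (at s)" for s
  have dg: "(g has_real_derivative dg s) (at s)" if "s \<in> I" for s
    using smooth_on_has_vector_derivative[OF g(1) that]
    by (simp add: dg_def has_real_derivative_iff_has_vector_derivative)
  have "smooth_on I dg"
    unfolding dg_def[abs_def] by (rule smooth_on_vector_derivative[OF g(1) open_I])
  from smooth_on_has_vector_derivative[OF this s]
  obtain ddg where ddg: "(dg has_real_derivative ddg) (at s)"
    by (auto simp: has_real_derivative_iff_has_vector_derivative)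
  have dg_s: "dg s = g'"
    using DERIV_unique[OF dg[OF s] g(2)] .
  have W': "vector_derivative W (at s) = (c * \<kappa> s - g s * \<tau> s) *\<^sub>R N s + dg s *\<^sub>R B s"
    if "s \<in> I" for s
  proof -
    have "((\<lambda>s. c *\<^sub>R T s + g s *\<^sub>R B s) has_vector_derivative
        (c *\<^sub>R (v s * \<kappa> s) *\<^sub>R N s + 0 *\<^sub>R T s)
        + (g s *\<^sub>R (- (v s * \<tau> s)) *\<^sub>R N s + dg s *\<^sub>R B s)) (at s)"
      by (intro has_vector_derivative_add has_vector_derivative_scaleR DERIV_const
          T_deriv[OF that] B_deriv[OF that] dg[OF that])
    then have "(W has_vector_derivative
        (c *\<^sub>R (v s * \<kappa> s) *\<^sub>R N s + 0 *\<^sub>R T s)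
        + (g s *\<^sub>R (- (v s * \<tau> s)) *\<^sub>R N s + dg s *\<^sub>R B s)) (at s)"
      by (rule has_vector_derivative_transform_within_open[OF _ open_I that]) (simp add: W)
    then show ?thesis
      using unit_speed[OF that] by (simp add: vector_derivative_at algebra_simps)
  qed
  have coeff: "((\<lambda>s. c * \<kappa> s - g s * \<tau> s) has_real_derivative c * \<kappa>' - (g' * \<tau> s + g s * \<tau>')) (at s)"
    by (rule derivative_eq_intros \<kappa>' \<tau>' g(2) refl | simp add: algebra_simps)+
  have "((\<lambda>s. (c * \<kappa> s - g s * \<tau> s) *\<^sub>R N s + dg s *\<^sub>R B s) has_vector_derivative
      ((c * \<kappa> s - g s * \<tau> s) *\<^sub>R v s *\<^sub>R (\<tau> s *\<^sub>R B s - \<kappa> s *\<^sub>R T s)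
        + (c * \<kappa>' - (g' * \<tau> s + g s * \<tau>')) *\<^sub>R N s)
      + (dg s *\<^sub>R (- (v s * \<tau> s)) *\<^sub>R N s + ddg *\<^sub>R B s)) (at s)"
    by (intro has_vector_derivative_add has_vector_derivative_scaleR coeff ddg
        N_deriv[OF s] B_deriv[OF s])
  then have "((\<lambda>s. vector_derivative W (at s)) has_vector_derivative
      ((c * \<kappa> s - g s * \<tau> s) *\<^sub>R v s *\<^sub>R (\<tau> s *\<^sub>R B s - \<kappa> s *\<^sub>R T s)
        + (c * \<kappa>' - (g' * \<tau> s + g s * \<tau>')) *\<^sub>R N s)
      + (dg s *\<^sub>R (- (v s * \<tau> s)) *\<^sub>R N s + ddg *\<^sub>R B s)) (at s)"
    by (rule has_vector_derivative_transform_within_open[OF _ open_I s]) (simp add: W')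
  note vector_derivative_at[OF this]
  then show ?thesis
    using NN[OF s] TN[OF s] NB[of s] unit_speed[OF s] dg_s
    by (simp add: inner_add_right inner_diff_right inner_commute)
qed

lemma obtain_derivs:
  assumes "s \<in> I"
  obtains \<kappa>' \<tau>' where "(\<kappa> has_real_derivative \<kappa>') (at s)" "(\<tau> has_real_derivative \<tau>') (at s)"
  using smooth_on_has_vector_derivative[OF smooth_curvature assms]
    smooth_on_has_vector_derivative[OF smooth_torsion assms]
  by (auto simp: has_real_derivative_iff_has_vector_derivative)

end

section \<open>The law \<open>c B / sqrt \<tau>\<close> preserves arc length and curvature\<close>

text \<open>Arc length comes before curvature, whose variation formula presupposes unit speed at the
  time considered.\<close>

lemma inv_sqrt_torsion_law_preserving:
  assumes ev: "evolves_by (inv_sqrt_torsion_law c) I J X" and "t \<in> J" "s \<in> I"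
  shows "speed (\<lambda>s. X s t) s = 1"
    and "((\<lambda>t. speed (\<lambda>s. X s t) s) has_real_derivative 0) (at t)"
    and "((\<lambda>t. curvature (\<lambda>s. X s t) s) has_real_derivative 0) (at t)"
proof -
  have I: "open I" and J: "is_interval J"
    using ev unfolding evolves_by_def by blast+
  obtain U where U: "open U" "I \<times> J \<subseteq> U" "smooth_on U (\<lambda>(s, t). X s t)"
    using ev unfolding evolves_by_def by blast
  interpret smooth_family U X
    by unfold_locales (use U in auto)
  define W where "W t s = 0 *\<^sub>R unit_tangent (\<lambda>s. X s t) s + 0 *\<^sub>R unit_normal (\<lambda>s. X s t) s
      + (c / sqrt (torsion (\<lambda>s. X s t) s)) *\<^sub>R unit_binormal (\<lambda>s. X s t) s" for t s
  have pos: "speed (\<lambda>s. X s t) s > 0" "curvature (\<lambda>s. X s t) s > 0" "torsion (\<lambda>s. X s t) s > 0"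
    and W: "((\<lambda>t. X s t) has_vector_derivative W t s) (at t)" if "s \<in> I" "t \<in> J" for s t
    using ev that unfolding evolves_by_def by (auto simp: inv_sqrt_torsion_law_def W_def)
  have slice: "I \<times> {t} \<subseteq> U" if "t \<in> J" for t
    using U(2) that by blast
  have frenet: "frenet_curve I (\<lambda>s. X s t)" if "t \<in> J" for t
    by (rule frenet_curve_slice[OF I slice[OF that]]) (use pos that in auto)
  have coeff: "((\<lambda>s. c / sqrt (torsion (\<lambda>s. X s t) s)) has_real_derivative
      - c * \<tau>' / (2 * torsion (\<lambda>s. X s t) s * sqrt (torsion (\<lambda>s. X s t) s))) (at s)"
    if "s \<in> I" "t \<in> J" "(torsion (\<lambda>s. X s t) has_real_derivative \<tau>') (at s)" for s t \<tau>'
    using pos(3)[OF that(1,2)] by (auto intro!: derivative_eq_intros that(3) simp: field_simps)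
  have tangential: "unit_tangent (\<lambda>s. X s t) s \<bullet> vector_derivative (W t) (at s) = 0"
    if st: "s \<in> I" "t \<in> J" for s t
  proof -
    interpret frenet_curve I "\<lambda>s. X s t"
      by (rule frenet[OF st(2)])
    obtain \<tau>' where "(torsion (\<lambda>s. X s t) has_real_derivative \<tau>') (at s)"
      using obtain_derivs[OF st(1)] by blast
    from tangential_variation[OF st(1) DERIV_const DERIV_const coeff[OF st this], of 0 0]
    show ?thesis
      by (simp add: W_def[abs_def])
  qed
  have speed0: "((\<lambda>t. speed (\<lambda>s. X s t) s) has_real_derivative 0) (at t)"
    if "s \<in> I" "t \<in> J" for s t
    using speed_variation[OF I slice[OF that(2)] that(1) pos(1)[OF that] W[OF _ that(2)]]
    by (simp add: tangential[OF that])
  obtain t0 where t0: "t0 \<in> J" "arclength_param_on I (\<lambda>s. X s t0)"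
    using ev unfolding evolves_by_def by blast
  have speed1: "speed (\<lambda>s. X s t) s = 1" if "s \<in> I" "t \<in> J" for s t
  proof -
    \<comment> \<open>At each \<open>s\<close> the speed is constant in time over the interval
      \<open>J\<close>; its value is read off at \<open>t0\<close>.\<close>
    have "\<exists>d. \<forall>t\<in>J. speed (\<lambda>s. X s t) s = d"
      using speed0[OF that(1)] is_interval_convex[OF J]
      by (intro has_field_derivative_zero_constant) (auto intro: has_field_derivative_at_within)
    then show ?thesis
      using t0 that by (auto simp: arclength_param_on_def)
  qed
  show "speed (\<lambda>s. X s t) s = 1" "((\<lambda>t. speed (\<lambda>s. X s t) s) has_real_derivative 0) (at t)"
    by (rule speed1 speed0, fact+)+
  interpret frenet_curve I "\<lambda>s. X s t"
    by (rule frenet[OF \<open>t \<in> J\<close>])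
  obtain \<kappa>' \<tau>' where derivs: "(\<kappa> has_real_derivative \<kappa>') (at s)" "(\<tau> has_real_derivative \<tau>') (at s)"
    using obtain_derivs[OF \<open>s \<in> I\<close>] by blast
  have "smooth_on I (\<lambda>s. c * inverse (sqrt (\<tau> s)))"
    using pos(3)[OF _ \<open>t \<in> J\<close>]
    by (intro smooth_on_mult smooth_on_const smooth_on_inverse smooth_on_sqrt smooth_torsion) force+
  then have "smooth_on I (\<lambda>s. c / sqrt (\<tau> s))"
    by (simp add: divide_inverse)
  then have "N s \<bullet> vector_derivative (\<lambda>s. vector_derivative (W t) (at s)) (at s)
      = 0 * \<kappa>' - 2 * (- c * \<tau>' / (2 * \<tau> s * sqrt (\<tau> s))) * \<tau> s - c / sqrt (\<tau> s) * \<tau>'"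
    by (intro normal_variation[OF \<open>s \<in> I\<close> _ _ _ coeff[OF \<open>s \<in> I\<close> \<open>t \<in> J\<close> derivs(2)] derivs])
      (use speed1[OF _ \<open>t \<in> J\<close>] in \<open>auto simp: W_def\<close>)
  \<comment> \<open>For \<open>g = c / sqrt \<tau>\<close> the product \<open>g^2 \<tau>\<close> is
    constant, and its derivative is \<open>g (2 g' \<tau> + g \<tau>')\<close>; this singles out the
    exponent -1/2.\<close>
  also have "\<dots> = 0"
    using pos(3)[OF \<open>s \<in> I\<close> \<open>t \<in> J\<close>] by (simp add: field_simps)
  finally have normal: "N s \<bullet> vector_derivative (\<lambda>s. vector_derivative (W t) (at s)) (at s) = 0" .
  have "arclength_param_on I (\<lambda>s. X s t)"
    using speed1[OF _ \<open>t \<in> J\<close>] by (simp add: arclength_param_on_def)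
  from curvature_variation[OF I slice[OF \<open>t \<in> J\<close>] \<open>s \<in> I\<close> this pos(2)[OF _ \<open>t \<in> J\<close>] W[OF _ \<open>t \<in> J\<close>]
      tangential[OF \<open>s \<in> I\<close> \<open>t \<in> J\<close>]]
  show "((\<lambda>t. curvature (\<lambda>s. X s t) s) has_real_derivative 0) (at t)"
    by (simp add: normal)
qed



section \<open>Curves with prescribed curvature and torsion jets\<close>

text \<open>\<open>A\<close>, \<open>C\<close>, \<open>D\<close> are the first three derivatives of
  \<open>T\<close>. From \<open>T'' = \<kappa> (\<tau> B - \<kappa> T) + \<kappa>' N\<close> one
  reads off \<open>\<kappa>'\<close> and \<open>\<kappa> \<tau>\<close>. The last identity makes
  \<open>\<tau>'\<close> accessible from \<open>T'''\<close>.\<close>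

lemma (in frenet_curve) tangent_jet:
  assumes s: "s \<in> I" and unit_speed: "\<And>u. u \<in> I \<Longrightarrow> v u = 1"
    and A: "\<And>u. u \<in> I \<Longrightarrow> (T has_vector_derivative A u) (at u)"
    and C: "\<And>u. u \<in> I \<Longrightarrow> (A has_vector_derivative C u) (at u)"
    and D: "(C has_vector_derivative D) (at s)"
    and derivs: "(\<kappa> has_real_derivative \<kappa>') (at s)" "(\<tau> has_real_derivative \<tau>') (at s)"
  shows "A s = \<kappa> s *\<^sub>R N s" "N s \<bullet> C s = \<kappa>'" "B s \<bullet> C s = \<kappa> s * \<tau> s"
    "B s \<bullet> D = 2 * \<kappa>' * \<tau> s + \<kappa> s * \<tau>'"
proof -
  have A_eq: "A u = \<kappa> u *\<^sub>R N u" if "u \<in> I" for u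
    using vector_derivative_unique_at[OF A[OF that] T_deriv[OF that]] unit_speed[OF that] by simp
  show "A s = \<kappa> s *\<^sub>R N s"
    by (rule A_eq[OF s])
  have C_eq: "C u = \<kappa> u *\<^sub>R v u *\<^sub>R (\<tau> u *\<^sub>R B u - \<kappa> u *\<^sub>R T u) + k' *\<^sub>R N u"
    if "u \<in> I" "(\<kappa> has_real_derivative k') (at u)" for u k'
  proof -
    have "((\<lambda>u. \<kappa> u *\<^sub>R N u) has_vector_derivative
        \<kappa> u *\<^sub>R v u *\<^sub>R (\<tau> u *\<^sub>R B u - \<kappa> u *\<^sub>R T u) + k' *\<^sub>R N u) (at u)"
      by (rule has_vector_derivative_scaleR[OF that(2) N_deriv[OF that(1)]])
    then have "(A has_vector_derivative
        \<kappa> u *\<^sub>R v u *\<^sub>R (\<tau> u *\<^sub>R B u - \<kappa> u *\<^sub>R T u) + k' *\<^sub>R N u) (at u)"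
      by (rule has_vector_derivative_transform_within_open[OF _ open_I that(1)]) (simp add: A_eq)
    then show ?thesis
      by (rule vector_derivative_unique_at[OF C[OF that(1)]])
  qed
  show NC: "N s \<bullet> C s = \<kappa>'"
    using NN[OF s] TN[OF s] NB[of s]
    by (simp add: C_eq[OF s derivs(1)] inner_add_right inner_diff_right inner_commute)
  have BC: "B u \<bullet> C u = \<kappa> u * \<tau> u" if u: "u \<in> I" for u
  proof -
    obtain k' where "(\<kappa> has_real_derivative k') (at u)"
      using obtain_derivs[OF u] by blast
    from C_eq[OF u this] show ?thesis
      using BB[OF u] TB[of u] NB[of u] unit_speed[OF u]
      by (simp add: inner_add_right inner_diff_right inner_commute)
  qed
  show "B s \<bullet> C s = \<kappa> s * \<tau> s"
    by (rule BC[OF s])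
  \<comment> \<open>Differentiating \<open>B \<bullet> T'' = \<kappa> \<tau>\<close> along the curve
    avoids expanding \<open>T'''\<close>: the term \<open>B' \<bullet> T''\<close> is
    \<open>- \<tau> \<kappa>'\<close>.\<close>
  have "((\<lambda>u. B u \<bullet> C u) has_vector_derivative B s \<bullet> D + (- (v s * \<tau> s)) *\<^sub>R N s \<bullet> C s) (at s)"
    by (rule bounded_bilinear.has_vector_derivative[OF bounded_bilinear_inner B_deriv[OF s] D])
  then have "((\<lambda>u. \<kappa> u * \<tau> u) has_real_derivative B s \<bullet> D + (- (v s * \<tau> s)) *\<^sub>R N s \<bullet> C s) (at s)"
    unfolding has_real_derivative_iff_has_vector_derivative
    by (rule has_vector_derivative_transform_within_open[OF _ open_I s BC])
  moreover have "((\<lambda>u. \<kappa> u * \<tau> u) has_real_derivative \<kappa>' * \<tau> s + \<tau>' * \<kappa> s) (at s)"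
    by (rule DERIV_mult[OF derivs])
  ultimately have "B s \<bullet> D + (- (v s * \<tau> s)) *\<^sub>R N s \<bullet> C s = \<kappa>' * \<tau> s + \<tau>' * \<kappa> s"
    by (rule DERIV_unique)
  then show "B s \<bullet> D = 2 * \<kappa>' * \<tau> s + \<kappa> s * \<tau>'"
    using NC unit_speed[OF s] by (simp add: algebra_simps)
qed

lemma frenet_curve_subset:
  assumes "frenet_curve I \<gamma>" "J \<subseteq> I" "open J"
  shows "frenet_curve J \<gamma>"
  using assms smooth_on_subset[of I \<gamma> J] unfolding frenet_curve_def by blast

lemma vector_derivative_component:
  fixes F :: "real \<Rightarrow> real^3"
  assumes "(F has_vector_derivative F') (at s)" "\<And>u. F u $ i = f u" "(f has_real_derivative f') (at s)"
  shows "F' $ i = f'"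
proof -
  have "(f has_vector_derivative F' $ i) (at s)"
    using bounded_linear.has_vector_derivative[OF bounded_linear_vec_nth assms(1), of i] assms(2) by simp
  then show ?thesis
    using assms(3) vector_derivative_unique_at
    unfolding has_real_derivative_iff_has_vector_derivative by blast
qed

text \<open>The curve is the integral of a curve on the unit sphere, given in spherical coordinates
  \<open>\<phi>\<close> and \<open>\<theta>\<close>; as \<open>\<theta>\<close> vanishes to second order, \<open>\<phi>\<close> determines the jet of \<open>\<kappa>\<close>, and the
  third component of the tangent has second derivative \<open>\<kappa> \<tau>\<close> and third derivative
  \<open>2 \<kappa>' \<tau> + \<kappa> \<tau>'\<close> at \<open>0\<close>.\<close>

lemma curve_with_jet:
  fixes k w a b :: real
  assumes "k > 0" "w > 0"
  obtains I \<gamma> where "is_interval I" "0 \<in> I" "frenet_curve I \<gamma>"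
    "\<And>s. s \<in> I \<Longrightarrow> speed \<gamma> s = 1" "\<And>s. s \<in> I \<Longrightarrow> torsion \<gamma> s > 0"
    "curvature \<gamma> 0 = k" "torsion \<gamma> 0 = w"
    "(curvature \<gamma> has_real_derivative a) (at 0)" "(torsion \<gamma> has_real_derivative b) (at 0)"
proof -
  \<comment> \<open>The value that \<open>tangent_jet\<close> prescribes for
    \<open>B \<bullet> T'''\<close> when the jet at 0 is \<open>k\<close>, \<open>w\<close>,
    \<open>a\<close>, \<open>b\<close>.\<close>
  define m where "m = 2 * a * w + k * b"
  define \<phi> where "\<phi> s = k * s + a * s^2 / 2" for s :: real
  define \<theta> where "\<theta> s = k * w * s^2 / 2 + m * s^3 / 6" for s :: real
  define \<phi>' where "\<phi>' s = k + a * s" for s :: real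
  define \<theta>' where "\<theta>' s = k * w * s + m * s^2 / 2" for s :: real
  define \<theta>'' where "\<theta>'' s = k * w + m * s" for s :: real
  have d: "(\<phi> has_real_derivative \<phi>' s) (at s)" "(\<theta> has_real_derivative \<theta>' s) (at s)"
    "(\<phi>' has_real_derivative a) (at s)" "(\<theta>' has_real_derivative \<theta>'' s) (at s)"
    "(\<theta>'' has_real_derivative m) (at s)" for s
    unfolding \<phi>_def[abs_def] \<theta>_def[abs_def] \<phi>'_def[abs_def] \<theta>'_def[abs_def] \<theta>''_def[abs_def]
    by (auto intro!: derivative_eq_intros simp: field_simps power2_eq_square)
  have at0: "\<phi> 0 = 0" "\<theta> 0 = 0" "\<phi>' 0 = k" "\<theta>' 0 = 0" "\<theta>'' 0 = k * w"
    by (simp_all add: \<phi>_def \<theta>_def \<phi>'_def \<theta>'_def \<theta>''_def)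
  have smooth_angles: "smooth_on UNIV \<phi>" "smooth_on UNIV \<theta>"
  proof -
    have "smooth_on UNIV (\<lambda>s::real. k * s + (a / 2) * (s * s))"
      "smooth_on UNIV (\<lambda>s::real. (k * w / 2) * (s * s) + (m / 6) * (s * (s * s)))"
      by (intro smooth_on_add smooth_on_mult smooth_on_const smooth_on_ident)+
    then show "smooth_on UNIV \<phi>" "smooth_on UNIV \<theta>"
      by (simp_all add: \<phi>_def[abs_def] \<theta>_def[abs_def] power2_eq_square power3_eq_cube mult.assoc)
  qed
  define S :: "real \<Rightarrow> real^3" where "S s = (cos (\<theta> s) * cos (\<phi> s)) *\<^sub>R axis 1 1
      + (cos (\<theta> s) * sin (\<phi> s)) *\<^sub>R axis 2 1 + sin (\<theta> s) *\<^sub>R axis 3 1" for s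
  have smooth_S: "smooth_on UNIV S"
    unfolding S_def[abs_def]
    by (intro smooth_on_add smooth_on_scaleR smooth_on_mult smooth_on_sin_cos smooth_angles smooth_on_const)
  have S_nth: "S s $ 1 = cos (\<theta> s) * cos (\<phi> s)" "S s $ 2 = cos (\<theta> s) * sin (\<phi> s)"
    "S s $ 3 = sin (\<theta> s)" for s
    by (simp_all add: S_def axis_def)
  have norm_S: "norm (S s) = 1" for s
  proof -
    have "S s \<bullet> S s = (cos (\<theta> s))^2 * ((cos (\<phi> s))^2 + (sin (\<phi> s))^2) + (sin (\<theta> s))^2"
      by (simp add: inner_vec_def sum_3 S_nth power2_eq_square algebra_simps del: sin_cos_squared_add sin_cos_squared_add2 sin_cos_squared_add3)
    also have "\<dots> = 1"
      by (simp only: sin_cos_squared_add2 mult_1_right)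
    finally show ?thesis
      by (simp only: norm_eq_1)
  qed
  define A where "A s = vector_derivative S (at s)" for s
  define C where "C s = vector_derivative A (at s)" for s
  define D where "D = vector_derivative C (at 0)"
  have smooth_A: "smooth_on UNIV A"
    unfolding A_def[abs_def] by (rule smooth_on_vector_derivative[OF smooth_S open_UNIV])
  have smooth_C: "smooth_on UNIV C"
    unfolding C_def[abs_def] by (rule smooth_on_vector_derivative[OF smooth_A open_UNIV])
  have dS: "(S has_vector_derivative A s) (at s)" and dA: "(A has_vector_derivative C s) (at s)"
    and dC: "(C has_vector_derivative D) (at 0)" for s
    using smooth_on_has_vector_derivative[OF smooth_S, of s] smooth_on_has_vector_derivative[OF smooth_A, of s]
      smooth_on_has_vector_derivative[OF smooth_C, of 0]
    by (simp_all only: A_def[symmetric] C_def[symmetric] D_def[symmetric] UNIV_I)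
  \<comment> \<open>Components that are differentiated again are computed for all \<open>s\<close>;
    those used only as end results (\<open>C2\<close>, \<open>D3\<close>) are evaluated at 0, where
    \<open>\<phi>\<close>, \<open>\<theta>\<close> and \<open>\<theta>'\<close> vanish.\<close>
  have A1: "A s $ 1 = - sin (\<theta> s) * \<theta>' s * cos (\<phi> s) - cos (\<theta> s) * sin (\<phi> s) * \<phi>' s" for s
    by (rule vector_derivative_component[OF dS S_nth(1)])
      (rule derivative_eq_intros d refl | simp add: algebra_simps)+
  have A2: "A s $ 2 = - sin (\<theta> s) * \<theta>' s * sin (\<phi> s) + cos (\<theta> s) * cos (\<phi> s) * \<phi>' s" for s
    by (rule vector_derivative_component[OF dS S_nth(2)])
      (rule derivative_eq_intros d refl | simp add: algebra_simps)+
  have A3: "A s $ 3 = cos (\<theta> s) * \<theta>' s" for s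
    by (rule vector_derivative_component[OF dS S_nth(3)])
      (rule derivative_eq_intros d refl | simp add: algebra_simps)+
  have C2: "C 0 $ 2 = a"
    by (rule vector_derivative_component[OF dA A2])
      (rule derivative_eq_intros d refl | simp add: at0)+
  have C3: "C s $ 3 = - sin (\<theta> s) * \<theta>' s * \<theta>' s + cos (\<theta> s) * \<theta>'' s" for s
    by (rule vector_derivative_component[OF dA A3])
      (rule derivative_eq_intros d refl | simp add: algebra_simps)+
  have D3: "D $ 3 = m"
    by (rule vector_derivative_component[OF dC C3])
      (rule derivative_eq_intros d refl | simp add: at0)+
  have S0: "S 0 = axis 1 1" and A0: "A 0 = k *\<^sub>R axis 2 1"
    by (simp_all add: vec_eq_iff forall_3 S_nth A1 A2 A3 at0 axis_def)

  \<comment> \<open>Starting the integral at -1 makes 0 an interior point, so the derivative there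
    is two-sided.\<close>
  define \<gamma> where "\<gamma> s = integral {-1..s} S" for s
  have d\<gamma>: "(\<gamma> has_vector_derivative S s) (at s)" if "s \<in> ball 0 1" for s
  proof -
    have s: "s \<in> {-1..1}" "s \<in> interior {-1..1}"
      using that by (auto simp: dist_real_def)
    have "(\<gamma> has_vector_derivative S s) (at s within {-1..1})"
      unfolding \<gamma>_def[abs_def]
      by (rule integral_has_vector_derivative[OF continuous_on_subset[OF smooth_on_imp_continuous_on[OF smooth_S]] s(1)])
        simp
    then show ?thesis
      using at_within_interior[OF s(2)] by simp
  qed
  have speed1: "speed \<gamma> s = 1" if "s \<in> ball 0 1" for s
    using vector_derivative_at[OF d\<gamma>[OF that]] norm_S by (simp add: speed_def)
  have tangent: "unit_tangent \<gamma> s = S s" if "s \<in> ball 0 1" for s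
    using vector_derivative_at[OF d\<gamma>[OF that]] speed1[OF that]
    by (simp add: unit_tangent_def arc_deriv_def)
  have d_tangent: "(unit_tangent \<gamma> has_vector_derivative A s) (at s)" if "s \<in> ball 0 1" for s
    by (rule has_vector_derivative_transform_within_open[OF dS open_ball that]) (simp add: tangent)
  have curv: "curvature \<gamma> s = norm (A s)" if "s \<in> ball 0 1" for s
    using vector_derivative_at[OF d_tangent[OF that]] speed1[OF that]
    by (simp add: curvature_def arc_deriv_def)
  \<comment> \<open>The curvature is \<open>|A|\<close>, nonzero at 0 and hence nearby. A second
    shrinking below does the same for the torsion, which can be controlled only once the frame is
    smooth.\<close>
  have "open (ball 0 1 \<inter> A -` (- {0}))"
    using smooth_on_imp_continuous_on[OF smooth_A]
    by (intro continuous_open_preimage open_Compl closed_singleton open_ball) (auto intro: continuous_on_subset)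
  moreover have "0 \<in> ball 0 1 \<inter> A -` (- {0})"
    using \<open>k > 0\<close> by (simp add: A0 axis_eq_0_iff)
  ultimately obtain r where r: "r > 0" "ball 0 r \<subseteq> ball 0 1 \<inter> A -` (- {0})"
    using open_contains_ball by metis
  have frenet: "frenet_curve (ball 0 r) \<gamma>"
  proof
    show "smooth_on (ball 0 r) \<gamma>"
      by (rule smooth_on_antiderivative[OF smooth_on_subset[OF smooth_S] d\<gamma>]) (use r in auto)
  qed (use r curv speed1 in force)+
  interpret F: frenet_curve "ball 0 r" \<gamma>
    by (rule frenet)
  have zero: "0 \<in> ball 0 r" "0 \<in> ball (0::real) 1"
    using r(1) by simp_all
  obtain \<kappa>' \<tau>' where derivs: "(curvature \<gamma> has_real_derivative \<kappa>') (at 0)"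
    "(torsion \<gamma> has_real_derivative \<tau>') (at 0)"
    using F.obtain_derivs[OF zero(1)] by blast
  have jet: "A 0 = curvature \<gamma> 0 *\<^sub>R unit_normal \<gamma> 0" "unit_normal \<gamma> 0 \<bullet> C 0 = \<kappa>'"
    "unit_binormal \<gamma> 0 \<bullet> C 0 = curvature \<gamma> 0 * torsion \<gamma> 0"
    "unit_binormal \<gamma> 0 \<bullet> D = 2 * \<kappa>' * torsion \<gamma> 0 + curvature \<gamma> 0 * \<tau>'"
    by (rule F.tangent_jet[OF zero(1) speed1 d_tangent dA dC derivs]; use r in blast)+
  have \<kappa>0: "curvature \<gamma> 0 = k"
    using curv[OF zero(2)] \<open>k > 0\<close> by (simp add: A0 norm_axis_1)
  have N0: "unit_normal \<gamma> 0 = axis 2 1"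
    using jet(1) \<open>k > 0\<close> by (simp add: A0 \<kappa>0)
  have B0: "unit_binormal \<gamma> 0 = axis 3 1"
    by (simp add: unit_binormal_def tangent[OF zero(2)] S0 N0 cross_basis)
  have \<kappa>': "\<kappa>' = a"
    using jet(2) by (simp add: N0 inner_axis' C2)
  have \<tau>0: "torsion \<gamma> 0 = w"
    using jet(3) \<open>k > 0\<close> by (simp add: B0 inner_axis' C3 at0 \<kappa>0)
  have \<tau>': "\<tau>' = b"
    using jet(4) \<open>k > 0\<close> by (simp add: B0 inner_axis' D3 m_def \<kappa>0 \<tau>0 \<kappa>')
  have "open (ball 0 r \<inter> torsion \<gamma> -` {0<..})"
    by (intro continuous_open_preimage smooth_on_imp_continuous_on[OF F.smooth_torsion] open_ball open_greaterThan)
  moreover have "0 \<in> ball 0 r \<inter> torsion \<gamma> -` {0<..}"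
    using zero \<tau>0 \<open>w > 0\<close> by simp
  ultimately obtain q where q: "q > 0" "ball 0 q \<subseteq> ball 0 r \<inter> torsion \<gamma> -` {0<..}"
    using open_contains_ball by metis
  show thesis
  proof
    show "is_interval (ball (0::real) q)"
      by (rule is_interval_ball_real)
    show "0 \<in> ball 0 q"
      using q(1) by simp
    show "frenet_curve (ball 0 q) \<gamma>"
      by (rule frenet_curve_subset[OF frenet]) (use q in auto)
    show "speed \<gamma> s = 1" if "s \<in> ball 0 q" for s
      by (rule speed1) (use q r that in blast)
    show "torsion \<gamma> s > 0" if "s \<in> ball 0 q" for s
      using q that by blast
  qed (use derivs \<kappa>0 \<tau>0 \<kappa>' \<tau>' in auto)
qed



section \<open>Necessity\<close>

lemma smooth_coefficients:
  assumes "frenet_curve I \<gamma>" "\<And>s. s \<in> I \<Longrightarrow> torsion \<gamma> s > 0"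
    and "smooth_on ({0<..} \<times> {0<..}) (\<lambda>(\<kappa>, \<tau>). h \<kappa> \<tau>)"
  shows "smooth_on I (\<lambda>s. h (curvature \<gamma> s) (torsion \<gamma> s))"
proof -
  interpret frenet_curve I \<gamma>
    by fact
  have "smooth_on I (\<lambda>s. (\<lambda>(\<kappa>, \<tau>). h \<kappa> \<tau>) (curvature \<gamma> s, torsion \<gamma> s))"
    by (intro smooth_on_compose[OF assms(3)] smooth_on_pair smooth_curvature smooth_torsion)
      (use curvature_pos assms(2) in auto)
  then show ?thesis
    by simp
qed

text \<open>The affine family \<open>X s t = \<gamma> s + t V s\<close>, at the single instant \<open>0\<close>.\<close>

lemma preserving_variation:
  assumes law: "smooth_law (h1, h2, h3)"
    and "arclength_preserving (h1, h2, h3)" "curvature_preserving (h1, h2, h3)"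
    and curve: "frenet_curve I \<gamma>" "is_interval I" "\<And>s. s \<in> I \<Longrightarrow> speed \<gamma> s = 1"
      "\<And>s. s \<in> I \<Longrightarrow> torsion \<gamma> s > 0"
    and "s \<in> I"
  shows "unit_tangent \<gamma> s \<bullet> vector_derivative (velocity (h1, h2, h3) \<gamma>) (at s) = 0"
    and "unit_normal \<gamma> s \<bullet>
      vector_derivative (\<lambda>s. vector_derivative (velocity (h1, h2, h3) \<gamma>) (at s)) (at s) = 0"
proof -
  interpret frenet_curve I \<gamma>
    by fact
  let ?h = "(h1, h2, h3)"
  define V where "V = velocity ?h \<gamma>"
  have "smooth_on I (\<lambda>s. h1 (\<kappa> s) (\<tau> s) *\<^sub>R T s + h2 (\<kappa> s) (\<tau> s) *\<^sub>R N s + h3 (\<kappa> s) (\<tau> s) *\<^sub>R B s)"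
    using law
    by (intro smooth_on_add smooth_on_scaleR smooth_coefficients[OF curve(1,4)] smooth_frame) auto
  then have "smooth_on I V"
    by (simp add: V_def velocity.simps[abs_def])
  define X where "X s t = \<gamma> s + t *\<^sub>R V s" for s t
  have X0: "(\<lambda>s. X s 0) = \<gamma>"
    by (simp add: X_def)
  let ?U = "I \<times> (UNIV :: real set)"
  have "smooth_on ?U (\<lambda>p. \<gamma> (fst p) + snd p *\<^sub>R V (fst p))"
    by (intro smooth_on_add smooth_on_scaleR smooth_on_compose[OF smooth_curve]
        smooth_on_compose[OF \<open>smooth_on I V\<close>] smooth_on_linear[OF bounded_linear_fst]
        smooth_on_linear[OF bounded_linear_snd] smooth_on_ident) auto
  then have smooth_X: "smooth_on ?U (\<lambda>(s, t). X s t)"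
    by (simp add: X_def case_prod_unfold)
  have open_U: "open ?U"
    by (intro open_Times open_I open_UNIV)
  interpret F: smooth_family ?U X
    by unfold_locales (fact open_U smooth_X)+
  have dX: "((\<lambda>t. X s t) has_vector_derivative V s) (at t)" for s t
    unfolding X_def by (auto intro!: derivative_eq_intros)
  have unit_speed: "arclength_param_on I (\<lambda>s. X s 0)"
    using curve(3) by (simp add: X0 arclength_param_on_def)
  have "is_interval {0::real}"
    by (simp add: is_interval_convex_1)
  \<comment> \<open>For \<open>t\<close> other than 0 the affine family need not obey the law. At
    time 0 its curve is \<open>\<gamma>\<close> and its velocity the prescribed one, which is all
    that \<open>J = {0}\<close> asks for.\<close>
  then have ev: "evolves_by ?h I {0} X"
    unfolding evolves_by_def
    using open_I curve(2) open_U smooth_X unit_speed speed_pos curvature_pos curve(4) dX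
    by (auto simp: X0 V_def[symmetric] simp del: velocity.simps intro!: exI[of _ ?U])
  have slice: "I \<times> {0} \<subseteq> ?U"
    by auto
  have "((\<lambda>t. speed (\<lambda>s. X s t) s) has_real_derivative 0) (at 0)"
    using assms(2) ev \<open>s \<in> I\<close> unfolding arclength_preserving_def by blast
  \<comment> \<open>Preservation says that the time derivative is 0, the variation formula says what
    it is; uniqueness equates the two. The curvature is treated alike.\<close>
  from DERIV_unique[OF F.speed_variation[OF open_I slice \<open>s \<in> I\<close> _ dX] this]
  have tangential: "unit_tangent \<gamma> s \<bullet> vector_derivative V (at s) = 0"
    using speed_pos[OF \<open>s \<in> I\<close>] by (simp add: X0)
  have "((\<lambda>t. curvature (\<lambda>s. X s t) s) has_real_derivative 0) (at 0)"
    using assms(3) ev \<open>s \<in> I\<close> unfolding curvature_preserving_def by blast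
  from DERIV_unique[OF F.curvature_variation[OF open_I slice \<open>s \<in> I\<close> unit_speed _ dX] this]
  have "unit_normal \<gamma> s \<bullet> vector_derivative (\<lambda>s. vector_derivative V (at s)) (at s) = 0"
    using curvature_pos tangential by (simp add: X0)
  with tangential
  show "unit_tangent \<gamma> s \<bullet> vector_derivative (velocity ?h \<gamma>) (at s) = 0"
    "unit_normal \<gamma> s \<bullet> vector_derivative (\<lambda>s. vector_derivative (velocity ?h \<gamma>) (at s)) (at s) = 0"
    by (simp_all only: V_def)
qed

lemma DERIV_compose_pair:
  fixes H :: "real \<times> real \<Rightarrow> real"
  assumes "(H has_derivative D) (at (x s, y s))"
    and "(x has_real_derivative x') (at s)" "(y has_real_derivative y') (at s)"
  shows "((\<lambda>s. H (x s, y s)) has_real_derivative D (x', y')) (at s)"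
proof -
  have "((\<lambda>s. (x s, y s)) has_derivative (\<lambda>r. (x' * r, y' * r))) (at s)"
    using assms(2,3) by (intro has_derivative_Pair) (simp_all add: has_field_derivative_def)
  from has_derivative_compose[OF this assms(1)]
  have "((\<lambda>s. H (x s, y s)) has_derivative (\<lambda>r. D (x' * r, y' * r))) (at s)" .
  moreover have "D (x' * r, y' * r) = D (x', y') * r" for r
    using linear_scale[OF has_derivative_linear[OF assms(1)], of r "(x', y')"] by (simp add: mult.commute)
  ultimately show ?thesis
    by (simp only: has_field_derivative_def)
qed

lemma preserving_law_eq:
  assumes law: "smooth_law (h1, h2, h3)"
    and preserving: "arclength_preserving (h1, h2, h3)" "curvature_preserving (h1, h2, h3)"
  obtains c where "\<And>\<kappa> \<tau>. \<kappa> > 0 \<Longrightarrow> \<tau> > 0 \<Longrightarrow> h2 \<kappa> \<tau> = 0 \<and> h3 \<kappa> \<tau> = c / sqrt \<tau>"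
proof -
  define quad where "quad = ({0<..} :: real set) \<times> ({0<..} :: real set)"
  define H1 where "H1 = (\<lambda>(\<kappa>, \<tau>). h1 \<kappa> \<tau>)"
  define H2 where "H2 = (\<lambda>(\<kappa>, \<tau>). h2 \<kappa> \<tau>)"
  define H3 where "H3 = (\<lambda>(\<kappa>, \<tau>). h3 \<kappa> \<tau>)"
  have smooth: "smooth_on quad H1" "smooth_on quad H2" "smooth_on quad H3"
    using law by (simp_all add: quad_def H1_def H2_def H3_def)
  define D1 where "D1 p = frechet_derivative H1 (at p)" for p
  define D2 where "D2 p = frechet_derivative H2 (at p)" for p
  define D3 where "D3 p = frechet_derivative H3 (at p)" for p
  have D: "(H1 has_derivative D1 p) (at p)" "(H2 has_derivative D2 p) (at p)"
    "(H3 has_derivative D3 p) (at p)" if "p \<in> quad" for p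
    unfolding D1_def D2_def D3_def by (intro smooth_on_has_derivative[OF _ that] smooth)+
  have quadI: "(k, w) \<in> quad" if "k > 0" "w > 0" for k w :: real
    using that by (simp add: quad_def)

  have D1_eq: "D1 (k, w) (a, b) = k * h2 k w" if "k > 0" "w > 0" for k w a b
  proof -
    obtain I \<gamma> where \<gamma>: "is_interval I" "0 \<in> I" "frenet_curve I \<gamma>"
      "\<And>s. s \<in> I \<Longrightarrow> speed \<gamma> s = 1" "\<And>s. s \<in> I \<Longrightarrow> torsion \<gamma> s > 0"
      and jet: "curvature \<gamma> 0 = k" "torsion \<gamma> 0 = w"
      "(curvature \<gamma> has_real_derivative a) (at 0)" "(torsion \<gamma> has_real_derivative b) (at 0)"
      using curve_with_jet[OF \<open>k > 0\<close> \<open>w > 0\<close>] by metis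
    \<comment> \<open>Folding \<open>jet\<close> rewrites \<open>k\<close>, \<open>w\<close> as
      curvature and torsion at 0, the form in which the chain rule along the curve applies to the
      coefficients.\<close>
    note at0 = D[OF quadI[OF \<open>k > 0\<close> \<open>w > 0\<close>], folded jet(1,2)]
    note derivs = at0[THEN DERIV_compose_pair[where x="curvature \<gamma>" and y="torsion \<gamma>" and s=0], OF jet(3,4)]
    from frenet_curve.tangential_variation[OF \<gamma>(3,2) derivs]
      preserving_variation(1)[OF law preserving \<gamma>(3,1,4,5,2)]
    show ?thesis
      using \<gamma>(4)[OF \<gamma>(2)] by (simp add: velocity.simps[abs_def] H1_def H2_def H3_def jet(1,2))
  qed
  \<comment> \<open>In \<open>D1_eq\<close> the left side is linear in \<open>(a, b)\<close> and the
    right side independent of it, so the jet \<open>(0, 0)\<close> forces both to vanish.\<close>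
  have h2: "h2 k w = 0" if "k > 0" "w > 0" for k w
    using D1_eq[OF that, of 0 0] linear_0[OF has_derivative_linear[OF D(1)[OF quadI[OF that]]]] that(1)
    by (simp add: zero_prod_def)
  have "\<exists>c. \<forall>p\<in>quad. H1 p = c"
  proof (rule has_derivative_zero_constant)
    show "convex quad"
      unfolding quad_def by (intro convex_Times convex_real_interval)
    show "(H1 has_derivative (\<lambda>h. 0)) (at p within quad)" if "p \<in> quad" for p
    proof -
      have "D1 p = (\<lambda>h. 0)"
        using that D1_eq h2 by (auto simp: quad_def fun_eq_iff)
      then show ?thesis
        using D(1)[OF that] by (simp add: has_derivative_at_withinI)
    qed
  qed
  then obtain c1 where c1: "\<forall>p\<in>quad. H1 p = c1" ..
  have h1: "h1 k w = c1" if "k > 0" "w > 0" for k w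
    using bspec[OF c1 quadI[OF that]] by (simp add: H1_def)

  \<comment> \<open>As \<open>(a, b)\<close> is arbitrary, this is one equation for each partial
    derivative of \<open>h3\<close>, obtained from the jets \<open>(1, 0)\<close> and
    \<open>(0, 1)\<close>.\<close>
  have D3_eq: "c1 * a - 2 * D3 (k, w) (a, b) * w - h3 k w * b = 0" if "k > 0" "w > 0" for k w a b
  proof -
    obtain I \<gamma> where \<gamma>: "is_interval I" "0 \<in> I" "frenet_curve I \<gamma>"
      "\<And>s. s \<in> I \<Longrightarrow> speed \<gamma> s = 1" "\<And>s. s \<in> I \<Longrightarrow> torsion \<gamma> s > 0"
      and jet: "curvature \<gamma> 0 = k" "torsion \<gamma> 0 = w"
      "(curvature \<gamma> has_real_derivative a) (at 0)" "(torsion \<gamma> has_real_derivative b) (at 0)"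
      using curve_with_jet[OF \<open>k > 0\<close> \<open>w > 0\<close>] by metis
    note at0 = D(3)[OF quadI[OF \<open>k > 0\<close> \<open>w > 0\<close>], folded jet(1,2)]
    have velocity_eq: "velocity (h1, h2, h3) \<gamma> s
        = c1 *\<^sub>R unit_tangent \<gamma> s + H3 (curvature \<gamma> s, torsion \<gamma> s) *\<^sub>R unit_binormal \<gamma> s"
      if "s \<in> I" for s
      using h1 h2 frenet_curve.curvature_pos[OF \<gamma>(3) that] \<gamma>(5)[OF that] by (simp add: H3_def)
    have "smooth_on I (\<lambda>s. H3 (curvature \<gamma> s, torsion \<gamma> s))"
      using smooth_coefficients[OF \<gamma>(3,5), of h3] law by (simp add: H3_def)
    from frenet_curve.normal_variation[where W="velocity (h1, h2, h3) \<gamma>",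
        OF \<gamma>(3,2,4) velocity_eq this
        DERIV_compose_pair[where x="curvature \<gamma>" and y="torsion \<gamma>" and s=0, OF at0 jet(3,4)] jet(3,4)]
      preserving_variation(2)[OF law preserving \<gamma>(3,1,4,5,2)]
    show ?thesis
      by (simp add: H3_def jet(1,2) del: velocity.simps)
  qed
  \<comment> \<open>\<open>sqrt w\<close> is the integrating factor of the
    \<open>\<tau>\<close>-equation \<open>h3' = - h3 / (2 w)\<close>.\<close>
  have const_\<tau>: "h3 k w * sqrt w = h3 k 1" if k: "k > 0" and w: "w > 0" for k w
  proof -
    have "\<exists>c. \<forall>w\<in>{0<..}. h3 k w * sqrt w = c"
    proof (rule has_field_derivative_zero_constant)
      show "((\<lambda>w. h3 k w * sqrt w) has_real_derivative 0) (at w within {0<..})" if "w \<in> {0<..}" for w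
      proof -
        have w: "w > 0"
          using that by simp
        have "((\<lambda>w. h3 k w) has_real_derivative D3 (k, w) (0, 1)) (at w)"
          using DERIV_compose_pair[where x="\<lambda>_. k" and y="\<lambda>w. w", OF D(3)[OF quadI[OF k w]] DERIV_const DERIV_ident]
          by (simp add: H3_def)
        moreover have "D3 (k, w) (0, 1) = - h3 k w / (2 * w)"
          using D3_eq[OF k w, of 0 1] w by (simp add: field_simps)
        ultimately have "((\<lambda>w. h3 k w) has_real_derivative - h3 k w / (2 * w)) (at w)"
          by simp
        from DERIV_mult[OF this DERIV_real_sqrt[OF w]]
        have "((\<lambda>w. h3 k w * sqrt w) has_real_derivative 0) (at w)"
          using w by (simp add: sqrt_divide_self_eq[symmetric])
        then show ?thesis
          by (rule has_field_derivative_at_within)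
      qed
    qed (rule convex_real_interval)
    then obtain c where "\<And>w. w > 0 \<Longrightarrow> h3 k w * sqrt w = c"
      by auto
    from this[OF w] this[of 1] show ?thesis
      by simp
  qed
  \<comment> \<open>Integrated \<open>\<kappa>\<close>-equation: \<open>h3\<close> is affine in
    \<open>\<kappa>\<close> with slope \<open>c1 / (2 w)\<close>.\<close>
  have affine_\<kappa>: "h3 k w - c1 * k / (2 * w) = h3 1 w - c1 / (2 * w)" if k: "k > 0" and w: "w > 0" for k w
  proof -
    have "\<exists>c. \<forall>k\<in>{0<..}. h3 k w - c1 * k / (2 * w) = c"
    proof (rule has_field_derivative_zero_constant)
      show "((\<lambda>k. h3 k w - c1 * k / (2 * w)) has_real_derivative 0) (at k within {0<..})"
        if "k \<in> {0<..}" for k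
      proof -
        have k: "k > 0"
          using that by simp
        have "((\<lambda>k. h3 k w) has_real_derivative D3 (k, w) (1, 0)) (at k)"
          using DERIV_compose_pair[where x="\<lambda>k. k" and y="\<lambda>_. w", OF D(3)[OF quadI[OF k w]] DERIV_ident DERIV_const]
          by (simp add: H3_def)
        moreover have "D3 (k, w) (1, 0) = c1 / (2 * w)"
          using D3_eq[OF k w, of 1 0] w by (simp add: field_simps)
        ultimately have "((\<lambda>k. h3 k w) has_real_derivative c1 / (2 * w)) (at k)"
          by simp
        then have "((\<lambda>k. h3 k w - c1 * k / (2 * w)) has_real_derivative 0) (at k)"
          using w by (auto intro!: derivative_eq_intros)
        then show ?thesis
          by (rule has_field_derivative_at_within)
      qed
    qed (rule convex_real_interval)
    then obtain c where "\<And>k. k > 0 \<Longrightarrow> h3 k w - c1 * k / (2 * w) = c"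
      by auto
    from this[OF k] this[of 1] show ?thesis
      by simp
  qed
  text \<open>\<open>h3 \<kappa> \<tau> sqrt \<tau>\<close> does not depend on \<open>\<tau>\<close>, but its slope in \<open>\<kappa>\<close> is \<open>c1 / (2 sqrt \<tau>)\<close>.\<close>
  have "c1 = 0"
    using const_\<tau>[of 1 4] const_\<tau>[of 2 4] affine_\<kappa>[of 2 1] affine_\<kappa>[of 2 4] by simp
  show thesis
  proof
    fix \<kappa> \<tau> :: real
    assume pos: "\<kappa> > 0" "\<tau> > 0"
    have "h3 \<kappa> \<tau> = h3 1 1 / sqrt \<tau>"
      using affine_\<kappa>[OF pos] const_\<tau>[of 1 \<tau>] pos \<open>c1 = 0\<close> by (simp add: field_simps)
    then show "h2 \<kappa> \<tau> = 0 \<and> h3 \<kappa> \<tau> = h3 1 1 / sqrt \<tau>"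
      using h2[OF pos] by simp
  qed
qed

lemma smooth_inv_sqrt_torsion_law: "smooth_law (inv_sqrt_torsion_law c)"
proof -
  have "smooth_on ({0<..} \<times> {0<..}) (\<lambda>p::real \<times> real. c * inverse (sqrt (snd p)))"
    by (intro smooth_on_mult smooth_on_const smooth_on_inverse smooth_on_sqrt
        smooth_on_linear[OF bounded_linear_snd] smooth_on_ident) auto
  then show ?thesis
    by (simp add: inv_sqrt_torsion_law_def case_prod_unfold divide_inverse)
qed

theorem theorem4:
  fixes h1 h2 h3 :: "real \<Rightarrow> real \<Rightarrow> real"
  assumes "smooth_law (h1, h2, h3)"
  shows "((\<exists>g. smooth_law g \<and> law_equiv (h1, h2, h3) g \<and>
              arclength_preserving g \<and> curvature_preserving g)
          \<longleftrightarrow> (\<exists>c. law_equiv (h1, h2, h3) (inv_sqrt_torsion_law c)))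
       \<and> (\<forall>c. arclength_preserving (inv_sqrt_torsion_law c) \<and>
              curvature_preserving (inv_sqrt_torsion_law c))"
proof -
  have preserving: "arclength_preserving (inv_sqrt_torsion_law c)"
    "curvature_preserving (inv_sqrt_torsion_law c)" for c
    unfolding arclength_preserving_def curvature_preserving_def arclength_param_on_def
    using inv_sqrt_torsion_law_preserving by blast+
  \<comment> \<open>The rigidity result is applied to the equivalent law \<open>g\<close>, as the
    tangential part \<open>h1\<close> of the given law is arbitrary. In the other direction the
    inverse square root law itself is the witness for \<open>g\<close>.\<close>
  have "\<exists>c. law_equiv (h1, h2, h3) (inv_sqrt_torsion_law c)"
    if g: "smooth_law g" "law_equiv (h1, h2, h3) g" "arclength_preserving g" "curvature_preserving g" for g
  proof -
    obtain g1 g2 g3 where g_eq: "g = (g1, g2, g3)"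
      by (cases g)
    obtain c where "\<And>\<kappa> \<tau>. \<kappa> > 0 \<Longrightarrow> \<tau> > 0 \<Longrightarrow> g2 \<kappa> \<tau> = 0 \<and> g3 \<kappa> \<tau> = c / sqrt \<tau>"
      using preserving_law_eq[OF g(1,3,4)[unfolded g_eq]] by blast
    then have "law_equiv (h1, h2, h3) (inv_sqrt_torsion_law c)"
      using g(2) by (simp add: g_eq inv_sqrt_torsion_law_def)
    then show ?thesis ..
  qed
  then show ?thesis
    using preserving smooth_inv_sqrt_torsion_law by blast
qed

end
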